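(* Let $a_1|a_1',\dots,a_q|a_q'$, $b_1|b_1',\dots,b_p|b_p'\in\Lambda_{\mathbb C}$ satisfy $$\operatorname{Re}(a_\alpha+a_\alpha')>0\ (1\le\alpha\le q),\qquad \operatorname{Re}(b_\beta+b_\beta')>0\ (1\le \beta\le p),$$ $$\sum_{\alpha=1}^q \operatorname{Re}(a_\alpha+a_\alpha')+\sum_{\beta=1}^p\operatorname{Re}(b_\beta+b_\beta')<p+q.$$ Let $G(z)={}_pG_q^{\mathbb C}\big[{(a|a')\atop (b|b')};z\big]$ for $z\in\mathbb C\setminus\{0\}$, and let $\Sigma_+^{\mathbb C}(z)$, $\Sigma_-^{\mathbb C}(z)$ be the expressions defined in the context. (a) If $q>p$, then $G(z)=\Sigma_+^{\mathbb C}(z)$; if $q<p$, then $G(z)=\Sigma_-^{\mathbb C}(z)$. (b) If $p=q$, then $G(z)=\Sigma_+^{\mathbb C}(z)$ if $|z|<1$, and $G(z)=\Sigma_-^{\mathbb C}(z)$ if $|z|>1$.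
   Context: $\Lambda_{\mathbb C}$ is the set of pairs $a|a'$ with $a,a'\in\mathbb C$ and $a-a'\in\mathbb Z$. For $z\in\mathbb C\setminus\{0\}$ and $a|a'\in\Lambda_{\mathbb C}$ put $z^{a|a'}:=z^a\bar z^{\,a'}:=(z/|z|)^{a-a'}|z|^{a+a'}$ (single-valued). In particular $z^{\frac{-k-\sigma}2|\frac{k-\sigma}2}=(z/|z|)^{-k}|z|^{-\sigma}$ for $k\in\mathbb Z$, $\sigma\in\mathbb C$. The Gamma function of the complex field is the meromorphic function on $\Lambda_{\mathbb C}$ given by $\Gamma^{\mathbb C}(a|a')=\dfrac{\Gamma(a)}{\Gamma(1-a')}$. For $k\in\mathbb Z$, $\sigma\in\mathbb C$ put $${}_p\mathcal K_q^{\mathbb C}\Big[{(a|a')\atop (b|b')};\tfrac{k+\sigma}2\Big|\tfrac{-k+\sigma}2\Big]:=\prod_{\alpha=1}^q\Gamma^{\mathbb C}\big(a_\alpha+\tfrac{k+\sigma}2\big|a_\alpha'+\tfrac{-k+\sigma}2\big)\prod_{\beta=1}^p\Gamma^{\mathbb C}\big(b_\beta+\tfrac{-k-\sigma}2\big|b_\beta'+\tfrac{k-\sigma}2\big)$$ and $${}_pG_q^{\mathbb C}\Big[{(a|a')\atop (b|b')};z\Big]:=\frac1{2\pi i}\sum_{k\in\mathbb Z}\int_{i\mathbb R}{}_p\mathcal K_q^{\mathbb C}\Big[{(a|a')\atop (b|b')};\tfrac{k+\sigma}2\Big|\tfrac{-k+\sigma}2\Big]\,z^{\frac{-k-\sigma}2|\frac{k-\sigma}2}\,d\sigma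 .$$ The integrals over the imaginary axis (taken upward) are understood as conditionally convergent improper integrals. The generalized hypergeometric series is, for $r\le s+1$, $c_1,\dots,c_r\in\mathbb C$ and $d_1,\dots,d_s\in\mathbb C\setminus\{0,-1,-2,\dots\}$, $${}_rF_s\Big[{c_1,\dots,c_r\atop d_1,\dots,d_s};x\Big]=\sum_{m\ge0}\frac{(c_1)_m\cdots(c_r)_m}{m!\,(d_1)_m\cdots(d_s)_m}x^m,\qquad (c)_m=c(c+1)\cdots(c+m-1).$$ A subscript $\setminus j$ on a list means that the $j$-th entry is omitted. Definition of $\Sigma^{\mathbb C}_\pm$: $$\Sigma_+^{\mathbb C}(z):=2\sum_{j=1}^q z^{a_j|a_j'}\prod_{\beta=1}^p\Gamma^{\mathbb C}(b_\beta+a_j|b_\beta'+a_j')\prod_{\alpha\ne j}\Gamma^{\mathbb C}(a_\alpha-a_j|a_\alpha'-a_j')$$ $$\times\ {}_pF_{q-1}\Big[{(b_\beta+a_j)_{\beta=1}^p\atop (1-a_\alpha+a_j)_{\setminus j}};(-1)^q z\Big]\ {}_pF_{q-1}\Big[{(b_\beta'+a_j')_{\beta=1}^p\atop (1-a_\alpha'+a_j')_{\setminus j}};(-1)^p\bar z\Big],$$ and $\Sigma_-^{\mathbb C}$ is obtained by exchanging the roles of $(a|a')$ and $(b|b')$ (and of $p$ and $q$) and replacing $z$ by $z^{-1}$: $$\Sigma_-^{\mathbb C}(z):=2\sum_{j=1}^p z^{-b_j|-b_j'}\prod_{\alpha=1}^q\Gamma^{\mathbb C}(a_\alpha+b_j|a_\alpha'+b_j')\prod_{\beta\ne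 j}\Gamma^{\mathbb C}(b_\beta-b_j|b_\beta'-b_j')$$ $$\times\ {}_qF_{p-1}\Big[{(a_\alpha+b_j)_{\alpha=1}^q\atop (1-b_\beta+b_j)_{\setminus j}};(-1)^p z^{-1}\Big]\ {}_qF_{p-1}\Big[{(a_\alpha'+b_j')_{\alpha=1}^q\atop (1-b_\beta'+b_j')_{\setminus j}};(-1)^q\bar z^{-1}\Big].$$ *)

theory Defs
  imports "HOL-Complex_Analysis.Complex_Analysis"
begin

section \<open>The set of pairs and the power function\<close>

definition Lambda_C :: "(complex \<times> complex) set" where
  "Lambda_C = {(a, a'). a - a' \<in> \<int>}"

text \<open>
  On \<open>Lambda_C\<close> the exponent \<open>a - a'\<close> is an integer, so the first factor is an integer power and
  does not depend on the branch of the logarithm behind \<open>powr\<close>. The base of the second factor is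
  a positive real number, for \<open>z \<noteq> 0\<close>.
\<close>

definition cpower :: "complex \<Rightarrow> complex \<Rightarrow> complex \<Rightarrow> complex" where
  "cpower z a a' = (z / of_real (norm z)) powr (a - a') * of_real (norm z) powr (a + a')"

section \<open>The Gamma function of the complex field\<close>

text \<open>
  Each connected component of \<open>Lambda_C\<close> is a complex line \<open>{(a + s, a' + s) | s}\<close>, and the quotient
  \<open>Gamma (a + s) / Gamma (1 - a' - s)\<close> is a meromorphic function of \<open>s\<close>. Its value is taken after
  removing singularities: if \<open>a\<close> is a nonpositive and \<open>a'\<close> a positive integer, both Gamma functions
  have a pole, and the quotient extends to a nonzero value there. (The library's plain quotient
  would be 0.) At a genuine pole the value is 0 by convention.
\<close>

definition GammaC :: "complex \<Rightarrow> complex \<Rightarrow> complex" where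
  "GammaC a a' = remove_sings (\<lambda>s. Gamma (a + s) / Gamma (1 - (a' + s))) 0"

definition GammaC_pole :: "complex \<Rightarrow> complex \<Rightarrow> bool" where
  "GammaC_pole a a' \<longleftrightarrow> a \<in> \<int>\<^sub>\<le>\<^sub>0 \<and> a' \<in> \<int>\<^sub>\<le>\<^sub>0"

lemma GammaC_eq:
  assumes "a \<notin> \<int>\<^sub>\<le>\<^sub>0"
  shows   "GammaC a a' = Gamma a / Gamma (1 - a')"
proof -
  have "isCont (\<lambda>s. Gamma (a + s) * rGamma (1 - (a' + s))) 0"
    using assms by (intro continuous_intros) auto
  then have "(\<lambda>s. Gamma (a + s) * rGamma (1 - (a' + s))) \<midarrow>0\<rightarrow> Gamma a * rGamma (1 - a')"
    by (simp add: isCont_def)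
  then show ?thesis
    unfolding GammaC_def
    by (intro remove_sings_eqI) (simp add: rGamma_inverse_Gamma divide_inverse)
qed

lemma GammaC_eq':
  assumes "a' \<notin> \<int>\<^sub>\<le>\<^sub>0" and "a - a' = of_int n"
  shows   "GammaC a a' = (-1) powi n * Gamma a' / Gamma (1 - a)"
proof -
  have "isCont (\<lambda>s. (-1) powi n * (Gamma (a' + s) * rGamma (1 - (a + s)))) 0"
    using assms by (intro continuous_intros) auto
  then have "(\<lambda>s. (-1) powi n * (Gamma (a' + s) * rGamma (1 - (a + s)))) \<midarrow>0\<rightarrow>
               (-1) powi n * (Gamma a' * rGamma (1 - a))"
    by (simp add: isCont_def)
  moreover have "eventually (\<lambda>s. (-1) powi n * (Gamma (a' + s) * rGamma (1 - (a + s)))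
                     = Gamma (a + s) / Gamma (1 - (a' + s))) (at 0)"
  proof -
    have "\<not> a islimpt (\<int> :: complex set)"
      by (rule discrete_imp_not_islimpt[of 1]) (auto elim!: Ints_cases simp: dist_of_int)
    then have "eventually (\<lambda>w. w \<notin> (\<int> :: complex set)) (at a)"
      by (auto simp: islimpt_iff_eventually)
    then have "eventually (\<lambda>s. a + s \<notin> (\<int> :: complex set)) (at 0)"
      by (simp add: at_to_0[of a] eventually_filtermap add.commute)
    then show ?thesis
    proof eventually_elim
      case (elim s)
      have aa: "a = a' + of_int n" using assms(2) by (simp add: algebra_simps)
      have 1: "rGamma (a + s) * rGamma (1 - (a + s)) = sin (of_real pi * (a + s)) / of_real pi"
        and 2: "rGamma (a' + s) * rGamma (1 - (a' + s)) = sin (of_real pi * (a' + s)) / of_real pi"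
        by (rule rGamma_reflection_complex)+
      have "cos (of_real (pi * of_int n) :: complex) = (-1) powi n"
        "sin (of_real (pi * of_int n) :: complex) = 0"
        unfolding cos_of_real sin_of_real by (auto simp: power_int_minus_left)
      moreover have "of_real pi * (a + s) = of_real pi * (a' + s) + of_real (pi * of_int n)"
        by (simp add: aa algebra_simps)
      ultimately have 3: "sin (of_real pi * (a + s)) = (-1) powi n * sin (of_real pi * (a' + s))"
        by (simp only: sin_add) simp
      have "a' + s \<notin> \<int>"
        using elim Ints_add[of "a' + s" "of_int n"] by (auto simp: aa add_ac)
      then have nz: "rGamma (a + s) \<noteq> 0" "rGamma (a' + s) \<noteq> 0"
        using elim by (auto simp: rGamma_eq_zero_iff)
      have *: "rGamma (a + s) * rGamma (1 - (a + s)) =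
              (-1) powi n * (rGamma (a' + s) * rGamma (1 - (a' + s)))"
        unfolding 1 2 3 by simp
      have sq: "(-1) powi n * (-1) powi n = (1 :: complex)"
        by (auto simp: power_int_minus_left)
      have "(-1) powi n * (rGamma (1 - (a + s)) / rGamma (a' + s)) =
              (-1) powi n * ((rGamma (a + s) * rGamma (1 - (a + s))) / (rGamma (a + s) * rGamma (a' + s)))"
        using nz by simp
      also have "\<dots> = ((-1) powi n * (-1) powi n) * (rGamma (1 - (a' + s)) / rGamma (a + s))"
        unfolding * using nz by (simp add: field_simps)
      finally show ?case
        by (simp add: sq Gamma_def divide_simps mult_ac)
    qed
  qed
  ultimately have "(\<lambda>s. Gamma (a + s) / Gamma (1 - (a' + s))) \<midarrow>0\<rightarrow>
                     (-1) powi n * (Gamma a' * rGamma (1 - a))"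
    by (rule Lim_transform_eventually)
  then show ?thesis
    unfolding GammaC_def
    by (intro remove_sings_eqI) (simp add: rGamma_inverse_Gamma divide_inverse mult.assoc)
qed

section \<open>The integral\<close>

text \<open>
  Lists of parameters \<open>a\<^sub>1|a'\<^sub>1, \<dots>, a\<^sub>q|a'\<^sub>q\<close> are given as functions \<open>a\<close>, \<open>a'\<close> of an index, of which only
  the values on \<open>{1..q}\<close> matter.
\<close>

definition kernelC ::
  "nat \<Rightarrow> nat \<Rightarrow> (nat \<Rightarrow> complex) \<Rightarrow> (nat \<Rightarrow> complex) \<Rightarrow> (nat \<Rightarrow> complex) \<Rightarrow> (nat \<Rightarrow> complex)
     \<Rightarrow> int \<Rightarrow> complex \<Rightarrow> complex" where
  "kernelC p q a a' b b' k \<sigma> =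
     (\<Prod>\<alpha>=1..q. GammaC (a \<alpha> + (of_int k + \<sigma>) / 2) (a' \<alpha> + (- of_int k + \<sigma>) / 2)) *
     (\<Prod>\<beta>=1..p. GammaC (b \<beta> + (- of_int k - \<sigma>) / 2) (b' \<beta> + (of_int k - \<sigma>) / 2))"

definition integrandC ::
  "nat \<Rightarrow> nat \<Rightarrow> (nat \<Rightarrow> complex) \<Rightarrow> (nat \<Rightarrow> complex) \<Rightarrow> (nat \<Rightarrow> complex) \<Rightarrow> (nat \<Rightarrow> complex)
     \<Rightarrow> complex \<Rightarrow> int \<Rightarrow> complex \<Rightarrow> complex" where
  "integrandC p q a a' b b' z k \<sigma> =
     kernelC p q a a' b b' k \<sigma> * cpower z ((- of_int k - \<sigma>) / 2) ((of_int k - \<sigma>) / 2)"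

text \<open>
  The integral along the imaginary axis is parametrised by \<open>\<sigma> = \<i> t\<close>, so \<open>d\<sigma> = \<i> dt\<close>. The
  Henstock-Kurzweil integral over \<open>UNIV\<close> is the limit of the integrals over compact intervals whose
  two endpoints tend to \<open>\<plusminus>\<infinity>\<close> independently of each other; in particular no absolute integrability
  is required, as is appropriate for conditionally convergent improper integrals.
\<close>

definition imag_axis_integrable :: "(complex \<Rightarrow> complex) \<Rightarrow> bool" where
  "imag_axis_integrable f \<longleftrightarrow> (\<lambda>t::real. f (\<i> * of_real t) * \<i>) integrable_on UNIV"

definition imag_axis_integral :: "(complex \<Rightarrow> complex) \<Rightarrow> complex" where
  "imag_axis_integral f = integral UNIV (\<lambda>t::real. f (\<i> * of_real t) * \<i>)"

definition meijerGC ::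
  "nat \<Rightarrow> nat \<Rightarrow> (nat \<Rightarrow> complex) \<Rightarrow> (nat \<Rightarrow> complex) \<Rightarrow> (nat \<Rightarrow> complex) \<Rightarrow> (nat \<Rightarrow> complex)
     \<Rightarrow> complex \<Rightarrow> complex" where
  "meijerGC p q a a' b b' z =
     1 / (2 * of_real pi * \<i>) *
     (\<Sum>\<^sub>\<infinity>k::int. imag_axis_integral (integrandC p q a a' b b' z k))"

definition meijerGC_converges ::
  "nat \<Rightarrow> nat \<Rightarrow> (nat \<Rightarrow> complex) \<Rightarrow> (nat \<Rightarrow> complex) \<Rightarrow> (nat \<Rightarrow> complex) \<Rightarrow> (nat \<Rightarrow> complex)
     \<Rightarrow> complex \<Rightarrow> bool" where
  "meijerGC_converges p q a a' b b' z \<longleftrightarrow>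
     (\<forall>k::int. imag_axis_integrable (integrandC p q a a' b b' z k)) \<and>
     (\<lambda>k::int. imag_axis_integral (integrandC p q a a' b b' z k)) summable_on UNIV"

section \<open>The hypergeometric expressions\<close>

definition hypergeomF :: "complex list \<Rightarrow> complex list \<Rightarrow> complex \<Rightarrow> complex" where
  "hypergeomF cs ds x = eval_fps (fps_hypergeo cs ds 1) x"

lemma hypergeomF_eq:
  "hypergeomF cs ds x =
     (\<Sum>m. (\<Prod>c\<leftarrow>cs. pochhammer c m) / (fact m * (\<Prod>d\<leftarrow>ds. pochhammer d m)) * x ^ m)"
proof -
  have "foldl (\<lambda>r c. r * f c) u xs = u * (\<Prod>c\<leftarrow>xs. f c)" for f :: "complex \<Rightarrow> complex" and u xs
    by (induction xs arbitrary: u) (simp_all add: mult.assoc)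
  then show ?thesis
    by (simp add: hypergeomF_def eval_fps_def mult.commute)
qed

definition SigmaC_plus ::
  "nat \<Rightarrow> nat \<Rightarrow> (nat \<Rightarrow> complex) \<Rightarrow> (nat \<Rightarrow> complex) \<Rightarrow> (nat \<Rightarrow> complex) \<Rightarrow> (nat \<Rightarrow> complex)
     \<Rightarrow> complex \<Rightarrow> complex" where
  "SigmaC_plus p q a a' b b' z =
     2 * (\<Sum>j=1..q.
       cpower z (a j) (a' j) *
       (\<Prod>\<beta>=1..p. GammaC (b \<beta> + a j) (b' \<beta> + a' j)) *
       (\<Prod>\<alpha>\<in>{1..q} - {j}. GammaC (a \<alpha> - a j) (a' \<alpha> - a' j)) *
       hypergeomF [b \<beta> + a j. \<beta> \<leftarrow> [1..<Suc p]]
                  [1 - a \<alpha> + a j. \<alpha> \<leftarrow> [1..<Suc q], \<alpha> \<noteq> j] ((-1) ^ q * z) *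
       hypergeomF [b' \<beta> + a' j. \<beta> \<leftarrow> [1..<Suc p]]
                  [1 - a' \<alpha> + a' j. \<alpha> \<leftarrow> [1..<Suc q], \<alpha> \<noteq> j] ((-1) ^ p * cnj z))"

definition SigmaC_minus ::
  "nat \<Rightarrow> nat \<Rightarrow> (nat \<Rightarrow> complex) \<Rightarrow> (nat \<Rightarrow> complex) \<Rightarrow> (nat \<Rightarrow> complex) \<Rightarrow> (nat \<Rightarrow> complex)
     \<Rightarrow> complex \<Rightarrow> complex" where
  "SigmaC_minus p q a a' b b' z =
     2 * (\<Sum>j=1..p.
       cpower z (- b j) (- b' j) *
       (\<Prod>\<alpha>=1..q. GammaC (a \<alpha> + b j) (a' \<alpha> + b' j)) *
       (\<Prod>\<beta>\<in>{1..p} - {j}. GammaC (b \<beta> - b j) (b' \<beta> - b' j)) *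
       hypergeomF [a \<alpha> + b j. \<alpha> \<leftarrow> [1..<Suc q]]
                  [1 - b \<beta> + b j. \<beta> \<leftarrow> [1..<Suc p], \<beta> \<noteq> j] ((-1) ^ p * inverse z) *
       hypergeomF [a' \<alpha> + b' j. \<alpha> \<leftarrow> [1..<Suc q]]
                  [1 - b' \<beta> + b' j. \<beta> \<leftarrow> [1..<Suc p], \<beta> \<noteq> j] ((-1) ^ q * inverse (cnj z)))"

text \<open>
  The expressions above make sense only if no Gamma factor is at a pole and no lower parameter of
  a hypergeometric series is a nonpositive integer. The following predicate says exactly this for
  \<open>SigmaC_plus\<close>; exchanging the two families of parameters gives it for \<open>SigmaC_minus\<close>.
\<close>

definition SigmaC_well_defined ::
  "nat \<Rightarrow> nat \<Rightarrow> (nat \<Rightarrow> complex) \<Rightarrow> (nat \<Rightarrow> complex) \<Rightarrow> (nat \<Rightarrow> complex) \<Rightarrow> (nat \<Rightarrow> complex)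
     \<Rightarrow> bool" where
  "SigmaC_well_defined p q a a' b b' \<longleftrightarrow>
     (\<forall>j\<in>{1..q}.
        (\<forall>\<beta>\<in>{1..p}. \<not> GammaC_pole (b \<beta> + a j) (b' \<beta> + a' j)) \<and>
        (\<forall>\<alpha>\<in>{1..q} - {j}. \<not> GammaC_pole (a \<alpha> - a j) (a' \<alpha> - a' j) \<and>
           1 - a \<alpha> + a j \<notin> \<int>\<^sub>\<le>\<^sub>0 \<and> 1 - a' \<alpha> + a' j \<notin> \<int>\<^sub>\<le>\<^sub>0))"

text \<open>Under the positivity assumptions on the parameters this is the usual nonresonance condition.\<close>

lemma SigmaC_well_defined_iff:
  assumes "\<And>\<alpha>. \<alpha> \<in> {1..q} \<Longrightarrow> (a \<alpha>, a' \<alpha>) \<in> Lambda_C"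
    and "\<And>\<alpha>. \<alpha> \<in> {1..q} \<Longrightarrow> Re (a \<alpha> + a' \<alpha>) > 0"
    and "\<And>\<beta>. \<beta> \<in> {1..p} \<Longrightarrow> Re (b \<beta> + b' \<beta>) > 0"
  shows "SigmaC_well_defined p q a a' b b' \<longleftrightarrow>
           (\<forall>j\<in>{1..q}. \<forall>\<alpha>\<in>{1..q} - {j}. a \<alpha> - a j \<notin> \<int>)"
proof -
  have A: "\<not> GammaC_pole (b \<beta> + a j) (b' \<beta> + a' j)" if "j \<in> {1..q}" "\<beta> \<in> {1..p}" for j \<beta>
    using assms(2)[OF that(1)] assms(3)[OF that(2)]
    by (auto simp: GammaC_pole_def complex_eq_iff add_ac elim!: nonpos_Ints_cases)
  have B: "(\<not> GammaC_pole u u' \<and> 1 - u \<notin> \<int>\<^sub>\<le>\<^sub>0 \<and> 1 - u' \<notin> \<int>\<^sub>\<le>\<^sub>0) \<longleftrightarrow> u \<notin> \<int>"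
    if "u - u' \<in> \<int>" for u u' :: complex
  proof (cases "u \<in> \<int>")
    case True
    then have "u' \<in> \<int>"
      using Ints_diff[OF True that] by simp
    with True obtain m n where mn: "u = of_int m" "u' = of_int n"
      by (auto elim!: Ints_cases)
    have "1 - of_int i = (of_int (1 - i) :: complex)" for i
      by simp
    then show ?thesis
      unfolding mn GammaC_pole_def by (auto simp only: of_int_in_nonpos_Ints_iff Ints_of_int)
  next
    case False
    then have "u' \<notin> \<int>"
      using Ints_add[OF that, of u'] by auto
    then have "1 - u \<notin> \<int>" "1 - u' \<notin> \<int>"
      using False Ints_diff[of 1 "1 - u"] Ints_diff[of 1 "1 - u'"] by auto
    with False show ?thesis
      by (auto simp: GammaC_pole_def)
  qed
  have "(\<not> GammaC_pole (a \<alpha> - a j) (a' \<alpha> - a' j) \<and>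
           1 - a \<alpha> + a j \<notin> \<int>\<^sub>\<le>\<^sub>0 \<and> 1 - a' \<alpha> + a' j \<notin> \<int>\<^sub>\<le>\<^sub>0) \<longleftrightarrow> a \<alpha> - a j \<notin> \<int>"
    if "j \<in> {1..q}" "\<alpha> \<in> {1..q} - {j}" for j \<alpha>
  proof -
    have "(a \<alpha> - a' \<alpha>) - (a j - a' j) \<in> \<int>"
      by (rule Ints_diff) (use assms(1)[of \<alpha>] assms(1)[of j] that in \<open>auto simp: Lambda_C_def\<close>)
    then have "(a \<alpha> - a j) - (a' \<alpha> - a' j) \<in> \<int>"
      by (simp add: algebra_simps)
    from B[OF this] show ?thesis
      by (simp add: algebra_simps)
  qed
  with A show ?thesis
    unfolding SigmaC_well_defined_def by blast
qed

end

(*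
For each k the integral over the imaginary axis is evaluated by pushing the contour to the left.
The bound |Gamma(x + iy)| <= C |y|^(x - x') |Gamma(x' + iy)| on vertical strips shows
that the integrand is O(|y|^-delta) with delta = p + q - sum Re(a + a') - sum Re(b + b') > 0 for
-2 <= Re sigma <= 0. The translation sigma -> sigma - 2 multiplies the integrand by a rational
function that is smaller than some rho < 1 in modulus near infinity, since q > p, or q = p and
|z| < 1. Hence the integrand decays exponentially to the left, and the improper integral equals
2 pi i times the sum of the residues at sigma = - a_j - a_j' - l - m with m - l = k + a_j - a_j'.
These poles are simple by nonresonance. Summed over k, the residues run through all (j, l, m), and
the term of (j, l, m) is the product of the l-th and the m-th term of the two hypergeometric series
in the j-th summand of Sigma_+. The expansion Sigma_- follows from the symmetry
(a, q, z, k, sigma) <-> (b, p, 1/z, -k, -sigma).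
*)

theory Submission
  imports Defs
begin

section \<open>Recurrences and holomorphy of the Gamma function of the complex field\<close>

text \<open>\<open>\<delta>\<close> may be arbitrarily small, so the bound on the imaginary axis
  gives no absolute integrability. This dictates the order of limits: the heights of the rectangle
  stay fixed while its left edge goes to infinity, and exponential decay in Re \<sigma> bounds the
  horizontal edges by O(T^-\<delta>) uniformly in the position of that edge. Only then do the two
  heights grow, independently of each other, as the integral over the whole line demands. The step 2
  is the smallest one natural to the problem: it moves both arguments of every Gamma factor by 1 and
  leaves k alone, so that the recurrences apply twice per factor. A growth bound on one strip of
  width 2 then propagates to the whole left half-plane, and the same contraction makes the left edge
  negligible. The recurrences must also hold where only one argument is a nonpositive integer and
  the plain quotient of Gamma functions has a wrong value; hence the case distinctions between the
  two formulas for \<open>GammaC\<close>. The sum over k is never exchanged with an integral: each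
  integral is one block of a triple series whose absolute convergence is proved separately.\<close>

text \<open>At a genuine pole the default value 0 would break the recurrence, for instance at a = a'
  = 0. Away from poles one of the two arguments is not a nonpositive integer, and the formula
  regular in that argument reduces the claim to the recurrence of \<open>Gamma\<close> or
  \<open>rGamma\<close>.\<close>

lemma GammaC_plus1_left:
  assumes "\<not> GammaC_pole a a'" and "a - a' \<in> \<int>"
  shows "GammaC (a + 1) a' = a * GammaC a a'"
proof (cases "a \<in> \<int>\<^sub>\<le>\<^sub>0")
  case False
  then have "a + 1 \<notin> \<int>\<^sub>\<le>\<^sub>0"
    using plus_one_in_nonpos_Ints_imp by blast
  then show ?thesis
    using False by (auto simp: GammaC_eq Gamma_plus1)
next
  case True
  with assms obtain n where n: "a' \<notin> \<int>\<^sub>\<le>\<^sub>0" "a - a' = of_int n"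
    by (auto simp: GammaC_pole_def elim!: Ints_cases)
  have *: "a + 1 - a' = of_int (n + 1)"
    using n(2) by (simp add: algebra_simps)
  show ?thesis
    unfolding GammaC_eq'[OF n] GammaC_eq'[OF n(1) *]
    using rGamma_plus1[of "- a", symmetric]
    by (simp add: power_int_add divide_inverse rGamma_inverse_Gamma[symmetric])
qed

text \<open>The minus sign comes from Gamma(1 - a') = -a' Gamma(-a').\<close>

lemma GammaC_plus1_right:
  assumes "\<not> GammaC_pole a a'" and "a - a' \<in> \<int>"
  shows "GammaC a (a' + 1) = - a' * GammaC a a'"
proof (cases "a \<in> \<int>\<^sub>\<le>\<^sub>0")
  case False
  then show ?thesis
    using rGamma_plus1[of "- a'", symmetric]
    by (simp add: GammaC_eq divide_inverse rGamma_inverse_Gamma[symmetric])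
next
  case True
  with assms obtain n where n: "a' \<notin> \<int>\<^sub>\<le>\<^sub>0" "a - a' = of_int n"
    by (auto simp: GammaC_pole_def elim!: Ints_cases)
  have *: "a - (a' + 1) = of_int (n - 1)"
    using n(2) by (simp add: algebra_simps)
  have **: "a' + 1 \<notin> \<int>\<^sub>\<le>\<^sub>0"
    using n(1) plus_one_in_nonpos_Ints_imp by blast
  show ?thesis
    unfolding GammaC_eq'[OF n] GammaC_eq'[OF ** *] using n(1)
    by (simp add: power_int_diff Gamma_plus1)
qed

lemma GammaC_pole_plus_left: "GammaC_pole (a + 1) a' \<Longrightarrow> GammaC_pole a a'"
  and GammaC_pole_plus_right: "GammaC_pole a (a' + 1) \<Longrightarrow> GammaC_pole a a'"
  by (auto simp: GammaC_pole_def dest: plus_one_in_nonpos_Ints_imp)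

text \<open>Shifts to the right never lead from a regular point to a pole, so the two recurrences
  can be iterated, in \<open>l\<close> and then in \<open>m\<close>. Only the second argument
  contributes signs.\<close>

lemma GammaC_shift:
  assumes "\<not> GammaC_pole a a'" and "a - a' \<in> \<int>"
  shows "GammaC (a + of_nat l) (a' + of_nat m) =
           (-1) ^ m * pochhammer a l * pochhammer a' m * GammaC a a'"
proof -
  have 1: "\<not> GammaC_pole (a + of_nat l) a' \<and>
           GammaC (a + of_nat l) a' = pochhammer a l * GammaC a a'" for l
  proof (induction l)
    case (Suc l)
    have "a + of_nat l - a' \<in> \<int>"
      using Ints_add[OF assms(2) Ints_of_nat[of l]] by (simp add: algebra_simps)
    with Suc show ?case
      using GammaC_plus1_left[of "a + of_nat l" a'] GammaC_pole_plus_left[of "a + of_nat l" a']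
      by (auto simp: pochhammer_Suc add_ac)
  qed (use assms in auto)
  have 2: "\<not> GammaC_pole (a + of_nat l) (a' + of_nat m) \<and>
           GammaC (a + of_nat l) (a' + of_nat m) =
             (-1) ^ m * pochhammer a' m * GammaC (a + of_nat l) a'" for m
  proof (induction m)
    case (Suc m)
    have "a + of_nat l - (a' + of_nat m) \<in> \<int>"
      using Ints_add[OF assms(2) Ints_diff[OF Ints_of_nat[of l] Ints_of_nat[of m]]]
      by (simp add: algebra_simps)
    with Suc show ?case
      using GammaC_plus1_right[of "a + of_nat l" "a' + of_nat m"]
        GammaC_pole_plus_right[of "a + of_nat l" "a' + of_nat m"]
      by (auto simp: pochhammer_Suc algebra_simps)
  qed (use 1[of l] in auto)
  show ?thesis
    using 1[of l] 2[of m] by simp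
qed

text \<open>This is \<open>GammaC_shift\<close> read backwards from the lowered point. Reversing the
  two Pochhammer symbols yields (-1)^l (-1)^m, and the second sign cancels against that of the
  upward shift. Nonintegrality of \<open>a\<close> keeps the lowered point regular and the
  denominators nonzero.\<close>

lemma GammaC_shift_minus:
  assumes "a \<notin> \<int>" and "a - a' \<in> \<int>"
  shows "GammaC (a - of_nat l) (a' - of_nat m) =
           (-1) ^ l * GammaC a a' / (pochhammer (1 - a) l * pochhammer (1 - a') m)"
proof -
  have nz: "a - of_nat l \<notin> \<int>"
    using assms(1) Ints_add[of "a - of_nat l" "of_nat l"] by auto
  have "a' \<notin> \<int>"
    using assms Ints_add[of "a - a'" "a'"] by auto
  then have nz': "1 - a' \<notin> \<int>"
    using Ints_diff[of 1 "1 - a'"] by auto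
  have nz1: "1 - a \<notin> \<int>"
    using assms(1) Ints_diff[of 1 "1 - a"] by auto
  have np: "pochhammer (1 - a) l \<noteq> 0" "pochhammer (1 - a') m \<noteq> 0"
    using nz' nz1 by (metis Ints_minus Ints_of_nat pochhammer_eq_0_iff)+
  have *: "a - of_nat l - (a' - of_nat m) \<in> \<int>"
    using Ints_diff[OF assms(2) Ints_diff[OF Ints_of_nat[of l] Ints_of_nat[of m]]]
    by (simp add: algebra_simps)
  have "\<not> GammaC_pole (a - of_nat l) (a' - of_nat m)"
    using nz nonpos_Ints_subset_Ints by (auto simp: GammaC_pole_def)
  from GammaC_shift[OF this *, of l m]
  have "GammaC a a' = (-1) ^ m * pochhammer (a - of_nat l) l * pochhammer (a' - of_nat m) m *
          GammaC (a - of_nat l) (a' - of_nat m)"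
    by simp
  also have "pochhammer (a - of_nat l) l = (-1) ^ l * pochhammer (1 - a) l"
    using pochhammer_minus[of "a - 1" l] by (simp add: power_mult_distrib[symmetric] algebra_simps)
  also have "pochhammer (a' - of_nat m) m = (-1) ^ m * pochhammer (1 - a') m"
    using pochhammer_minus[of "a' - 1" m] by (simp add: power_mult_distrib[symmetric] algebra_simps)
  finally show ?thesis
    using np by (simp add: field_simps power_mult_distrib[symmetric])
qed

text \<open>The formulas \<open>GammaC_eq\<close> and \<open>GammaC_eq'\<close> act as two charts:
  each is holomorphic where its own numerator is, and the two open domains together cover everything
  but the genuine poles.\<close>

lemma GammaC_holomorphic:
  assumes "a - a' \<in> \<int>"
  shows "(\<lambda>s. GammaC (a + s) (a' + s)) holomorphic_on {s. \<not> GammaC_pole (a + s) (a' + s)}"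
proof -
  from assms obtain n where n: "a - a' = of_int n"
    by (auto elim!: Ints_cases)
  have op: "open {s. c + s \<notin> \<int>\<^sub>\<le>\<^sub>0}" for c :: complex
  proof -
    have "open ((\<lambda>s. c + s) -` (- \<int>\<^sub>\<le>\<^sub>0))"
      by (intro open_vimage continuous_intros) (simp add: open_Compl)
    then show ?thesis
      by (simp add: vimage_def)
  qed
  have "(\<lambda>s. GammaC (a + s) (a' + s)) holomorphic_on {s. a + s \<notin> \<int>\<^sub>\<le>\<^sub>0}"
  proof (rule holomorphic_transform)
    show "(\<lambda>s. Gamma (a + s) * rGamma (1 - (a' + s))) holomorphic_on {s. a + s \<notin> \<int>\<^sub>\<le>\<^sub>0}"
      by (auto intro!: holomorphic_intros)
  qed (simp add: GammaC_eq rGamma_inverse_Gamma divide_inverse)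
  moreover
  have "(\<lambda>s. GammaC (a + s) (a' + s)) holomorphic_on {s. a' + s \<notin> \<int>\<^sub>\<le>\<^sub>0}"
  proof (rule holomorphic_transform)
    show "(\<lambda>s. (-1) powi n * Gamma (a' + s) * rGamma (1 - (a + s))) holomorphic_on {s. a' + s \<notin> \<int>\<^sub>\<le>\<^sub>0}"
      by (auto intro!: holomorphic_intros)
  next
    fix s assume "s \<in> {s. a' + s \<notin> \<int>\<^sub>\<le>\<^sub>0}"
    then show "(-1) powi n * Gamma (a' + s) * rGamma (1 - (a + s)) = GammaC (a + s) (a' + s)"
      using n by (subst GammaC_eq'[where n = n]) (auto simp: rGamma_inverse_Gamma divide_inverse)
  qed
  ultimately have "(\<lambda>s. GammaC (a + s) (a' + s)) holomorphic_on
      ({s. a + s \<notin> \<int>\<^sub>\<le>\<^sub>0} \<union> {s. a' + s \<notin> \<int>\<^sub>\<le>\<^sub>0})"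
    by (intro holomorphic_on_Un op)
  also have "{s. a + s \<notin> \<int>\<^sub>\<le>\<^sub>0} \<union> {s. a' + s \<notin> \<int>\<^sub>\<le>\<^sub>0} = {s. \<not> GammaC_pole (a + s) (a' + s)}"
    by (auto simp: GammaC_pole_def)
  finally show ?thesis .
qed

lemma GammaC_pole_imp_Re_le: "GammaC_pole a a' \<Longrightarrow> Re (a + a') \<le> 0"
  by (auto simp: GammaC_pole_def elim!: nonpos_Ints_cases)

text \<open>The numerator Gamma(a + s) has residue (-1)^l / l! at \<open>s0\<close>, while the
  reciprocal Gamma factor is regular there with value 1 / m!.\<close>

lemma GammaC_simple_pole:
  assumes "a + s0 = - of_nat l" and "a' + s0 = - of_nat m"
  shows "(\<lambda>s. GammaC (a + s) (a' + s) * (s - s0)) \<midarrow>s0\<rightarrow> (-1) ^ l / (fact l * fact m)"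
proof -
  have "filterlim (\<lambda>s. a + s) (at (- of_nat l)) (at s0)"
    unfolding assms(1)[symmetric] filterlim_at
    by (auto simp: eventually_at_filter intro!: tendsto_intros)
  from filterlim_compose[OF Gamma_residues this]
  have "(\<lambda>s. Gamma (a + s) * (a + s + of_nat l)) \<midarrow>s0\<rightarrow> (-1) ^ l / fact l" .
  moreover have "a + s + of_nat l = s - s0" for s
    using assms(1) by (metis add.commute add_diff_cancel_left' add_uminus_conv_diff diff_minus_eq_add group_cancel.sub1)
  ultimately have 1: "(\<lambda>s. Gamma (a + s) * (s - s0)) \<midarrow>s0\<rightarrow> (-1) ^ l / fact l"
    by simp
  have "isCont (\<lambda>s. rGamma (1 - (a' + s))) s0"
    by (intro continuous_intros)
  then have 2: "(\<lambda>s. rGamma (1 - (a' + s))) \<midarrow>s0\<rightarrow> rGamma (1 - (a' + s0))"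
    by (simp add: isCont_def)
  have 3: "rGamma (1 - (a' + s0)) = 1 / fact m"
    unfolding assms(2) using Gamma_fact[of m, where 'a = complex]
    by (simp add: rGamma_inverse_Gamma add_ac divide_inverse)
  have "eventually (\<lambda>s. s \<in> ball s0 1 - {s0}) (at s0)"
    by (intro eventually_at_in_open) auto
  then have ev: "eventually (\<lambda>s. Gamma (a + s) * (s - s0) * rGamma (1 - (a' + s)) =
               GammaC (a + s) (a' + s) * (s - s0)) (at s0)"
  proof eventually_elim
    case (elim s)
    \<comment> \<open>Within distance 1 of \<open>s0\<close> no other point has \<open>a + s\<close>
      integral, so \<open>GammaC\<close> is the plain quotient there.\<close>
    have "a + s \<notin> \<int>\<^sub>\<le>\<^sub>0"
    proof
      assume "a + s \<in> \<int>\<^sub>\<le>\<^sub>0"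
      then have "(a + s) - (a + s0) \<in> \<int>"
        unfolding assms(1) using nonpos_Ints_subset_Ints by (intro Ints_diff) auto
      then obtain i where i: "s - s0 = of_int i"
        by (auto elim!: Ints_cases)
      have "norm (s - s0) < 1" "s \<noteq> s0"
        using elim by (auto simp: dist_norm norm_minus_commute)
      then have "i = 0"
        unfolding i by simp
      with i \<open>s \<noteq> s0\<close> show False
        by simp
    qed
    then show ?case
      by (simp add: GammaC_eq rGamma_inverse_Gamma divide_inverse)
  qed
  from Lim_transform_eventually[OF tendsto_mult[OF 1 2] ev] show ?thesis
    unfolding 3 by simp
qed

section \<open>Growth on vertical strips\<close>

lemma has_real_derivative_Re_horizontal:
  assumes "(f has_field_derivative D) (at (Complex x y))"
  shows "((\<lambda>x. Re (f (Complex x y))) has_real_derivative Re D) (at x)"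
proof -
  have "((\<lambda>x. of_real x + \<i> * of_real y) has_vector_derivative 1) (at x)"
    by (auto intro!: derivative_eq_intros)
  then have "((\<lambda>x. Complex x y) has_vector_derivative 1) (at x)"
    by (simp add: complex_eq_iff[of "Complex _ _"] Complex_eq)
  from field_vector_diff_chain_at[OF this assms]
  have "((\<lambda>x. f (Complex x y)) has_vector_derivative D) (at x)"
    by (simp add: o_def)
  from bounded_linear.has_vector_derivative[OF bounded_linear_Re this] show ?thesis
    by (simp add: has_real_derivative_iff_has_vector_derivative)
qed

lemma Complex_notin_nonpos_Reals: "y \<noteq> 0 \<Longrightarrow> Complex x y \<notin> \<real>\<^sub>\<le>\<^sub>0"
  by (auto simp: complex_nonpos_Reals_iff)

lemma Complex_notin_nonpos_Ints: "y \<noteq> 0 \<Longrightarrow> Complex x y \<notin> \<int>\<^sub>\<le>\<^sub>0"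
  using nonpos_Ints_subset_nonpos_Reals Complex_notin_nonpos_Reals by blast

text \<open>The series of 1 / (z + k)^2 is dominated termwise, uniformly in the half-plane: the
  distance of y from 0 keeps the terms bounded and the real parts make them summable.\<close>

lemma trigamma_bounded_on_halfplane:
  fixes A :: real
  obtains M where "M \<ge> 0"
    "\<And>x y. A \<le> x \<Longrightarrow> \<bar>y\<bar> \<ge> 1 \<Longrightarrow> norm (Polygamma 1 (Complex x y)) \<le> M"
proof -
  \<comment> \<open>From index \<open>n\<close> on, x + k is at least k - n for every x to the right
    of \<open>A\<close>; truncated subtraction turns the bound into 0 for the earlier indices, where
    the summand 1 in \<open>g\<close> takes over.\<close>
  define n where "n = nat \<lceil>- A\<rceil>"
  define g where "g = (\<lambda>k::nat. 1 / ((real (k - n))\<^sup>2 + 1))"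
  have "summable (\<lambda>k::nat. 1 / ((real k)\<^sup>2 + 1))"
  proof (rule summable_comparison_test')
    show "summable (\<lambda>k. inverse (real k ^ 2))"
      by (rule inverse_power_summable) simp
    show "norm (1 / ((real k)\<^sup>2 + 1)) \<le> inverse (real k ^ 2)" if "k \<ge> 1" for k
      using that by (simp add: divide_simps add_pos_nonneg)
  qed
  then have "summable g"
    unfolding g_def by (subst summable_iff_shift[of _ n, symmetric]) simp
  have "norm (Polygamma 1 (Complex x y)) \<le> suminf g" if "A \<le> x" "\<bar>y\<bar> \<ge> 1" for x y
  proof -
    have "norm (inverse ((Complex x y + of_nat k) ^ 2)) \<le> g k" for k
    proof -
      have "real (k - n) \<le> \<bar>x + real k\<bar>"
        using \<open>A \<le> x\<close> unfolding n_def by linarith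
      then have "(real (k - n))\<^sup>2 \<le> (x + real k)\<^sup>2"
        by (metis abs_le_square_iff abs_of_nat)
      moreover have "1 \<le> y\<^sup>2"
        using that(2) abs_le_square_iff[of 1 y] by simp
      ultimately have "(real (k - n))\<^sup>2 + 1 \<le> (x + real k)\<^sup>2 + y\<^sup>2"
        by simp
      also have "\<dots> = norm ((Complex x y + of_nat k) ^ 2)"
        by (simp add: norm_power cmod_power2)
      finally have *: "(real (k - n))\<^sup>2 + 1 \<le> norm ((Complex x y + of_nat k) ^ 2)" .
      have "0 < (real (k - n))\<^sup>2 + 1"
        by (simp add: add_nonneg_pos)
      from le_imp_inverse_le[OF * this] show ?thesis
        unfolding g_def by (simp only: norm_inverse norm_divide norm_one inverse_eq_divide)
    qed
    then have "norm (\<Sum>k. inverse ((Complex x y + of_nat k) ^ 2)) \<le> suminf g"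
      by (intro norm_suminf_le \<open>summable g\<close>)
    then show ?thesis
      by (simp add: Polygamma_def numeral_2_eq_2)
  qed
  moreover have "suminf g \<ge> 0"
    by (intro suminf_nonneg \<open>summable g\<close>) (auto simp: g_def)
  ultimately show ?thesis
    using that by blast
qed

lemma ln_norm_Gamma: "z \<notin> \<int>\<^sub>\<le>\<^sub>0 \<Longrightarrow> ln (norm (Gamma z)) = Re (ln_Gamma z)" for z :: complex
  by (simp add: Gamma_complex_altdef norm_exp_eq_Re)

lemma ln_norm_Gamma_has_derivative:
  assumes "y \<noteq> 0"
  shows "((\<lambda>x. ln (norm (Gamma (Complex x y)))) has_real_derivative Re (Digamma (Complex x y))) (at x)"
  using has_real_derivative_Re_horizontal[OF has_field_derivative_ln_Gamma_complex,
      OF Complex_notin_nonpos_Reals[OF assms]] assms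
  by (simp add: ln_norm_Gamma Complex_notin_nonpos_Ints)

text \<open>
  By the mean value theorem and \<open>Gamma (z + 1) = z * Gamma z\<close>, \<open>Re Digamma\<close> takes the value
  \<open>ln (norm z)\<close> somewhere on the segment from \<open>z\<close> to \<open>z + 1\<close>, and its derivative is bounded.
\<close>

lemma Re_Digamma_on_strip:
  fixes A B :: real
  obtains M where "M \<ge> 0"
    "\<And>x y. A \<le> x \<Longrightarrow> x \<le> B \<Longrightarrow> \<bar>y\<bar> \<ge> 1 \<Longrightarrow> \<bar>Re (Digamma (Complex x y)) - ln \<bar>y\<bar>\<bar> \<le> M"
proof -
  obtain M where M: "M \<ge> 0" "\<And>x y. A \<le> x \<Longrightarrow> \<bar>y\<bar> \<ge> 1 \<Longrightarrow> norm (Polygamma 1 (Complex x y)) \<le> M"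
    using trigamma_bounded_on_halfplane by blast
  define R where "R = \<bar>A\<bar> + \<bar>B\<bar>"
  have "\<bar>Re (Digamma (Complex x y)) - ln \<bar>y\<bar>\<bar> \<le> M + ln (R + 1)"
    if xy: "A \<le> x" "x \<le> B" "\<bar>y\<bar> \<ge> 1" for x y
  proof -
    define z where "z = Complex x y"
    from xy have y0: "y \<noteq> 0"
      by auto
    have z: "z \<notin> \<int>\<^sub>\<le>\<^sub>0" "z \<noteq> 0" "Complex (x + 1) y = z + 1"
      using y0 by (auto simp: z_def Complex_notin_nonpos_Ints complex_eq_iff)
    have "\<exists>u>x. u < x + 1 \<and> ln (norm (Gamma (Complex (x + 1) y))) - ln (norm (Gamma (Complex x y))) =
            (x + 1 - x) * Re (Digamma (Complex u y))"
      by (rule MVT2) (use ln_norm_Gamma_has_derivative[OF y0] in auto)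
    then obtain u where u: "x < u" "u < x + 1"
      "Re (Digamma (Complex u y)) = ln (norm (Gamma (Complex (x + 1) y))) - ln (norm (Gamma z))"
      unfolding z_def by auto
    have "norm (Gamma (Complex (x + 1) y)) = norm z * norm (Gamma z)"
      using z by (simp add: Gamma_plus1 norm_mult)
    with u(3) z have eq: "Re (Digamma (Complex u y)) = ln (norm z)"
      by (simp add: ln_mult Gamma_eq_zero_iff)
    have "\<bar>y\<bar> \<le> norm z" "norm z \<le> \<bar>x\<bar> + \<bar>y\<bar>"
      unfolding z_def using abs_Im_le_cmod[of "Complex x y"] cmod_le[of "Complex x y"] by auto
    moreover have "\<bar>x\<bar> + \<bar>y\<bar> \<le> (R + 1) * \<bar>y\<bar>"
    proof -
      have "\<bar>x\<bar> * 1 \<le> R * \<bar>y\<bar>"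
        by (intro mult_mono) (use xy in \<open>auto simp: R_def\<close>)
      then show ?thesis
        by (simp add: algebra_simps)
    qed
    moreover have "R \<ge> 0"
      by (simp add: R_def)
    ultimately have "ln \<bar>y\<bar> \<le> ln (norm z)" "ln (norm z) \<le> ln ((R + 1) * \<bar>y\<bar>)"
      using z(2) y0 by (auto intro!: ln_mono simp del: abs_ge_self)
    moreover have "ln ((R + 1) * \<bar>y\<bar>) = ln (R + 1) + ln \<bar>y\<bar>"
      using \<open>R \<ge> 0\<close> y0 by (simp add: ln_mult)
    ultimately have 1: "\<bar>ln (norm z) - ln \<bar>y\<bar>\<bar> \<le> ln (R + 1)"
      by linarith
    have "\<exists>v>x. v < u \<and> Re (Digamma (Complex u y)) - Re (Digamma (Complex x y)) =
            (u - x) * Re (Polygamma 1 (Complex v y))"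
    proof (rule MVT2[OF u(1)])
      fix v :: real
      show "((\<lambda>x. Re (Digamma (Complex x y))) has_real_derivative Re (Polygamma 1 (Complex v y))) (at v)"
        using has_field_derivative_Polygamma[OF Complex_notin_nonpos_Ints[OF y0], where n = 0]
        by (intro has_real_derivative_Re_horizontal) simp
    qed
    then obtain v where v: "x < v" "v < u"
      "Re (Digamma (Complex u y)) - Re (Digamma (Complex x y)) = (u - x) * Re (Polygamma 1 (Complex v y))"
      by auto
    have "\<bar>(u - x) * Re (Polygamma 1 (Complex v y))\<bar> \<le> 1 * M"
      unfolding abs_mult using u v xy M(2)[of v y] abs_Re_le_cmod[of "Polygamma 1 (Complex v y)"]
      by (intro mult_mono) auto
    with v(3) eq 1 show ?thesis
      by linarith
  qed
  moreover have "M + ln (R + 1) \<ge> 0"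
    using M(1) by (simp add: R_def)
  ultimately show ?thesis
    using that by blast
qed

text \<open>For fixed y, subtracting x ln |y| from ln |Gamma(x + iy)| leaves a function of x with
  derivative Re Digamma - ln |y|, which is bounded on the strip. Its variation across the strip is
  therefore bounded independently of y, and exponentiating gives the power of |y|.\<close>

lemma Gamma_ratio_on_strip:
  fixes A B :: real
  obtains C where "C > 0"
    "\<And>x x' y. x \<in> {A..B} \<Longrightarrow> x' \<in> {A..B} \<Longrightarrow> \<bar>y\<bar> \<ge> 1 \<Longrightarrow>
       norm (Gamma (Complex x y)) \<le> C * \<bar>y\<bar> powr (x - x') * norm (Gamma (Complex x' y))"
proof -
  obtain M where M: "M \<ge> 0" "\<And>x y. A \<le> x \<Longrightarrow> x \<le> B \<Longrightarrow> \<bar>y\<bar> \<ge> 1 \<Longrightarrow>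
      \<bar>Re (Digamma (Complex x y)) - ln \<bar>y\<bar>\<bar> \<le> M"
    using Re_Digamma_on_strip by blast
  define C where "C = exp (M * \<bar>B - A\<bar>)"
  have main: "norm (Gamma (Complex x y)) \<le> C * \<bar>y\<bar> powr (x - x') * norm (Gamma (Complex x' y))"
    if xy: "x \<in> {A..B}" "x' \<in> {A..B}" "\<bar>y\<bar> \<ge> 1" for x x' y
  proof -
    from xy have y0: "y \<noteq> 0"
      by auto
    define f where "f = (\<lambda>x. ln (norm (Gamma (Complex x y))) - x * ln \<bar>y\<bar>)"
    have der: "(f has_real_derivative Re (Digamma (Complex u y)) - ln \<bar>y\<bar>) (at u)" for u
    proof -
      have "((\<lambda>x. x * ln \<bar>y\<bar>) has_real_derivative ln \<bar>y\<bar>) (at u)"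
        by (auto intro!: derivative_eq_intros)
      then show ?thesis
        unfolding f_def by (intro DERIV_diff ln_norm_Gamma_has_derivative[OF y0])
    qed
    have "norm (f x - f x') \<le> M * norm (x - x')"
    proof (rule field_differentiable_bound[where S = "{A..B}"])
      show "(f has_real_derivative Re (Digamma (Complex u y)) - ln \<bar>y\<bar>) (at u within {A..B})" for u
        using der by (rule has_field_derivative_at_within)
    qed (use xy M in auto)
    also have "\<dots> \<le> M * \<bar>B - A\<bar>"
      using xy M(1) by (intro mult_left_mono) auto
    finally have "f x \<le> f x' + M * \<bar>B - A\<bar>"
      by simp
    then have "ln (norm (Gamma (Complex x y))) \<le>
        M * \<bar>B - A\<bar> + (x - x') * ln \<bar>y\<bar> + ln (norm (Gamma (Complex x' y)))"
      unfolding f_def by (simp add: algebra_simps)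
    then have "exp (ln (norm (Gamma (Complex x y)))) \<le>
        exp (M * \<bar>B - A\<bar> + (x - x') * ln \<bar>y\<bar> + ln (norm (Gamma (Complex x' y))))"
      by simp
    then show ?thesis
      using y0 Complex_notin_nonpos_Ints[OF y0]
      by (simp add: exp_add C_def powr_def Gamma_eq_zero_iff)
  qed
  show ?thesis
    by (rule that[of C]) (use main in \<open>auto simp: C_def\<close>)
qed

section \<open>Improper integrals by residues\<close>

text \<open>The integral of exp(l x) over the negative half-line is 1 / l, so the bound does not
  depend on \<open>X\<close>. This is what permits moving the left edge to infinity at fixed
  height.\<close>

lemma horizontal_contour_integral_bound:
  assumes cont: "continuous_on (closed_segment (Complex (- X) y) (Complex 0 y)) F"
    and "X > 0" "l > 0"
    and bound: "\<And>x. x \<le> 0 \<Longrightarrow> norm (F (Complex x y)) \<le> M * exp (l * x)"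
  shows "norm (contour_integral (linepath (Complex (- X) y) (Complex 0 y)) F) \<le> M / l"
proof -
  let ?g = "linepath (Complex (- X) y) (Complex 0 y)"
  have g: "?g x = Complex (X * x - X) y" for x
    by (simp add: linepath_def complex_eq_iff algebra_simps)
  have d: "Complex 0 y - Complex (- X) y = of_real X"
    by (simp add: complex_eq_iff)
  have "M \<ge> 0"
    using order_trans[OF norm_ge_zero bound[of 0]] by simp
  have ci: "F contour_integrable_on ?g"
    by (rule contour_integrable_continuous_linepath[OF cont])
  have int: "(\<lambda>x. F (?g x) * of_real X) integrable_on {0..1}"
    using ci unfolding contour_integrable_on_def has_contour_integral_linepath d
    by (auto simp: integrable_on_def)
  have hi: "((\<lambda>x. M * exp (l * (X * x - X)) * X) has_integral
           M / l * exp (l * (X * 1 - X)) - M / l * exp (l * (X * 0 - X))) {0..1}"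
    by (rule fundamental_theorem_of_calculus)
       (use \<open>l > 0\<close> in \<open>auto intro!: derivative_eq_intros
          simp: has_real_derivative_iff_has_vector_derivative[symmetric]\<close>)
  have "norm (contour_integral ?g F) = norm (integral {0..1} (\<lambda>x. F (?g x) * of_real X))"
    using ci has_contour_integral_integral[of F ?g]
    unfolding has_contour_integral_linepath d by (metis integral_unique)
  also have "\<dots> \<le> integral {0..1} (\<lambda>x. M * exp (l * (X * x - X)) * X)"
  proof (rule integral_norm_bound_integral[OF int has_integral_integrable[OF hi]])
    fix x :: real assume "x \<in> {0..1}"
    then have "X * x - X \<le> 0"
      using \<open>X > 0\<close> by (simp add: mult_left_le)
    from bound[OF this] show "norm (F (?g x) * of_real X) \<le> M * exp (l * (X * x - X)) * X"
      unfolding g norm_mult using \<open>X > 0\<close> by simp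
  qed
  also have "\<dots> = M / l - M / l * exp (- l * X)"
    using integral_unique[OF hi] by simp
  also have "\<dots> \<le> M / l"
    using \<open>M \<ge> 0\<close> \<open>l > 0\<close> by simp
  finally show ?thesis .
qed

text \<open>The contour argument, detached from Gamma functions. Poles are listed by an injective
  \<open>h\<close> so that the residue sum can be an unordered sum over the index set.
  \<open>U\<close> reaches beyond the imaginary axis to make the right edge interior.
  \<open>left_small\<close> concerns bounded heights only, because the heights are held fixed while
  \<open>X n\<close> grows; the estimate \<open>bound\<close> takes care of the rest.\<close>

locale left_residue_sum =
  fixes F :: "complex \<Rightarrow> complex" and U :: "complex set"
    and h :: "'i \<Rightarrow> complex" and r :: "'i \<Rightarrow> complex" and Q :: "'i set" and S :: complex
    and T0 \<delta> l C :: real and X :: "nat \<Rightarrow> real"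
  assumes U: "open U" "convex U" "{\<sigma>. Re \<sigma> \<le> 0} \<subseteq> U"
    and holo: "F holomorphic_on U - h ` Q"
    and inj: "inj_on h Q"
    and Re_neg: "\<And>x. x \<in> Q \<Longrightarrow> Re (h x) < 0"
    and Im_bound: "\<And>x. x \<in> Q \<Longrightarrow> \<bar>Im (h x)\<bar> < T0"
    and fin: "\<And>Y. finite {x \<in> Q. Re (h x) > - Y}"
    and res: "\<And>x. x \<in> Q \<Longrightarrow> residue F (h x) = r x"
    and has_sum: "(r has_sum S) Q"
    and pos: "T0 > 0" "\<delta> > 0" "l > 0" "C \<ge> 0"
    and bound: "\<And>x y. x \<le> 0 \<Longrightarrow> \<bar>y\<bar> \<ge> T0 \<Longrightarrow>
                  norm (F (Complex x y)) \<le> C * \<bar>y\<bar> powr (- \<delta>) * exp (l * x)"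
    and X_top: "filterlim X at_top sequentially"
    and X_regular: "\<And>n x. x \<in> Q \<Longrightarrow> Re (h x) \<noteq> - X n"
    and left_small: "\<And>T e. e > 0 \<Longrightarrow>
          eventually (\<lambda>n. \<forall>y\<in>{- T..T}. norm (F (Complex (- X n) y)) \<le> e) sequentially"
begin

abbreviation "poles_right Y \<equiv> {x \<in> Q. Re (h x) > - Y}"

lemma rectangle_residues:
  assumes Xn: "X n > 0" and T: "T1 \<ge> T0" "T2 \<ge> T0"
  defines "R \<equiv> rectpath (Complex (- X n) (- T1)) (Complex 0 T2)"
  shows "path_image R \<subseteq> U - h ` Q"
    and "contour_integral R F = 2 * pi * \<i> * (\<Sum>x\<in>poles_right (X n). r x)"
proof -
  let ?a = "Complex (- X n) (- T1)" and ?b = "Complex 0 T2"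
  have le: "Re ?a \<le> Re ?b" "Im ?a \<le> Im ?b"
    using Xn T pos by auto
  have "z \<notin> h ` Q" if "z \<in> path_image R" for z
  proof
    assume "z \<in> h ` Q"
    then obtain x where x: "x \<in> Q" "z = h x"
      by auto
    from that le consider "Re z = - X n" | "Re z = 0" | "Im z = - T1" | "Im z = T2"
      unfolding R_def by (subst (asm) path_image_rectpath) auto
    then show False
      using x Re_neg[of x] Im_bound[of x] X_regular[of x n] T by cases auto
  qed
  moreover have "path_image R \<subseteq> cbox ?a ?b"
    unfolding R_def by (rule path_image_rectpath_subset_cbox[OF le])
  then have sub: "Re z \<in> {- X n..0}" if "z \<in> path_image R" for z
    using that by (auto simp: in_cbox_complex_iff subset_iff)
  ultimately show img: "path_image R \<subseteq> U - h ` Q"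
    using U(3) by fastforce
  \<comment> \<open>The residue theorem is applied with finitely many singularities, so the domain
    is cut off one unit to the left of the rectangle. The poles in the extra unit lie outside the
    rectangle and have winding number 0.\<close>
  define V where "V = U \<inter> {z. Re z > - X n - 1}"
  define P where "P = h ` poles_right (X n + 1)"
  have [simp]: "finite P"
    unfolding P_def by (intro finite_imageI fin)
  have inV: "z \<in> V" if "z \<in> cbox ?a ?b" for z
    using that U(3) by (auto simp: V_def in_cbox_complex_iff)
  have "contour_integral R F = 2 * pi * \<i> * (\<Sum>z\<in>P. winding_number R z * residue F z)"
  proof (rule Residue_theorem)
    show "open V"
      unfolding V_def by (intro open_Int U open_halfspace_Re_gt)
    show "connected V"
      unfolding V_def by (intro convex_connected convex_Int U convex_halfspace_Re_gt)
    show "F holomorphic_on V - P"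
      by (rule holomorphic_on_subset[OF holo]) (auto simp: V_def P_def)
    show "path_image R \<subseteq> V - P"
      using img sub by (fastforce simp: V_def P_def)
    show "\<forall>z. z \<notin> V \<longrightarrow> winding_number R z = 0"
      unfolding R_def using inV by (auto intro!: winding_number_rectpath_outside le)
  qed (auto simp: R_def)
  also have "(\<Sum>z\<in>P. winding_number R z * residue F z) =
             (\<Sum>x\<in>poles_right (X n + 1). winding_number R (h x) * residue F (h x))"
    unfolding P_def by (subst sum.reindex) (auto intro: inj_on_subset[OF inj])
  also have "\<dots> = (\<Sum>x\<in>poles_right (X n). r x)"
  proof (rule sum.mono_neutral_cong_right)
    show "\<forall>x\<in>poles_right (X n + 1) - poles_right (X n). winding_number R (h x) * residue F (h x) = 0"
    proof
      fix x assume "x \<in> poles_right (X n + 1) - poles_right (X n)"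
      then have "h x \<notin> cbox ?a ?b"
        using X_regular[of x n] by (auto simp: in_cbox_complex_iff)
      then show "winding_number R (h x) * residue F (h x) = 0"
        unfolding R_def using winding_number_rectpath_outside[OF le] by simp
    qed
  next
    fix x assume x: "x \<in> poles_right (X n)"
    then have "h x \<in> box ?a ?b"
      using Re_neg[of x] Im_bound[of x] T by (auto simp: in_box_complex_iff)
    then show "winding_number R (h x) * residue F (h x) = r x"
      unfolding R_def using winding_number_rectpath x res[of x] by simp
  qed (use fin[of "X n + 1"] in auto)
  finally show "contour_integral R F = 2 * pi * \<i> * (\<Sum>x\<in>poles_right (X n). r x)" .
qed

text \<open>As n grows, the left edge contributes at most e (T1 + T2) for every e > 0, hence nothing
  in the limit; the horizontal edges keep the stated bound for all n. The heights are separate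
  variables since the endpoints of the improper integral are independent.\<close>

lemma integral_minus_residues_bound:
  assumes T: "T1 \<ge> T0" "T2 \<ge> T0"
  shows "norm (integral {- T1..T2} (\<lambda>t. F (\<i> * of_real t) * \<i>) - 2 * pi * \<i> * S)
           \<le> C / l * (T1 powr (- \<delta>) + T2 powr (- \<delta>))"
proof -
  define J where "J = integral {- T1..T2} (\<lambda>t. F (\<i> * of_real t) * \<i>)"
  define Sn where "Sn n = (\<Sum>x\<in>poles_right (X n). r x)" for n
  define B where "B = C / l * (T1 powr (- \<delta>) + T2 powr (- \<delta>))"
  have T': "T1 > 0" "T2 > 0"
    using T pos by auto
  \<comment> \<open>The finite sets of poles inside the rectangles exhaust \<open>Q\<close>, so the
    unordered sum can be evaluated along them.\<close>
  have "filterlim (\<lambda>n. poles_right (X n)) (finite_subsets_at_top Q) sequentially"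
    unfolding filterlim_finite_subsets_at_top
  proof safe
    fix A assume A: "finite A" "A \<subseteq> Q"
    have "eventually (\<lambda>n. X n > Max (insert 0 ((\<lambda>x. - Re (h x)) ` A))) sequentially"
      using X_top by (simp add: filterlim_at_top_dense)
    then show "eventually (\<lambda>n. finite (poles_right (X n)) \<and> A \<subseteq> poles_right (X n) \<and> poles_right (X n) \<subseteq> Q) sequentially"
    proof eventually_elim
      case (elim n)
      have "- Re (h x) < X n" if "x \<in> A" for x
      proof -
        have "- Re (h x) \<le> Max (insert 0 ((\<lambda>x. - Re (h x)) ` A))"
          using that A by (intro Max_ge) auto
        with elim show ?thesis by linarith
      qed
      with A fin show ?case by force
    qed
  qed
  with has_sum have "Sn \<longlonglongrightarrow> S"
    unfolding has_sum_def Sn_def by (rule filterlim_compose)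
  then have lim: "(\<lambda>n. norm (J - 2 * pi * \<i> * Sn n)) \<longlonglongrightarrow> norm (J - 2 * pi * \<i> * S)"
    by (intro tendsto_intros)
  have "norm (J - 2 * pi * \<i> * S) \<le> B + e * (T1 + T2)" if e: "e > 0" for e
  proof (rule tendsto_upperbound[OF lim])
    have "eventually (\<lambda>n. X n > 0) sequentially"
      using X_top by (simp add: filterlim_at_top_dense)
    with left_small[OF e, of "max T1 T2"]
    show "eventually (\<lambda>n. norm (J - 2 * pi * \<i> * Sn n) \<le> B + e * (T1 + T2)) sequentially"
    proof eventually_elim
      case (elim n)
      let ?a1 = "Complex (- X n) (- T1)" and ?a2 = "Complex 0 (- T1)"
      let ?a3 = "Complex 0 T2" and ?a4 = "Complex (- X n) T2"
      let ?I = "\<lambda>a b. contour_integral (linepath a b) F"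
      note rect = rectangle_residues[OF elim(2) T]
      have R: "rectpath ?a1 ?a3 = linepath ?a1 ?a2 +++ linepath ?a2 ?a3 +++ linepath ?a3 ?a4 +++ linepath ?a4 ?a1"
        by (simp add: rectpath_def Let_def)
      have "path_image (rectpath ?a1 ?a3) = closed_segment ?a1 ?a2 \<union> closed_segment ?a2 ?a3 \<union>
              closed_segment ?a3 ?a4 \<union> closed_segment ?a4 ?a1"
        unfolding R by (simp add: path_image_join Un_assoc)
      with rect(1) have cont: "continuous_on (closed_segment ?a1 ?a2) F" "continuous_on (closed_segment ?a2 ?a3) F"
         "continuous_on (closed_segment ?a3 ?a4) F" "continuous_on (closed_segment ?a4 ?a1) F"
        by (auto intro!: continuous_on_subset[OF holomorphic_on_imp_continuous_on[OF holo]])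
      note ci = cont[THEN contour_integrable_continuous_linepath]
      have "contour_integral (rectpath ?a1 ?a3) F = ?I ?a1 ?a2 + (?I ?a2 ?a3 + (?I ?a3 ?a4 + ?I ?a4 ?a1))"
        unfolding R using ci by simp
      moreover have "?I ?a2 ?a3 = J"
      proof -
        have "?I ?a2 ?a3 = \<i> * integral {- T1..T2} (\<lambda>x. F (Complex 0 x))"
          by (rule contour_integral_linepath_same_Re) (use T' in auto)
        then show ?thesis
          by (simp add: J_def Complex_eq mult.commute)
      qed
      ultimately have "J - 2 * pi * \<i> * Sn n = - ?I ?a1 ?a2 - ?I ?a3 ?a4 - ?I ?a4 ?a1"
        unfolding rect(2) Sn_def by (simp add: algebra_simps add_eq_0_iff)
      then have "norm (J - 2 * pi * \<i> * Sn n) \<le> norm (?I ?a1 ?a2) + norm (?I ?a3 ?a4) + norm (?I ?a4 ?a1)"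
        by (smt (verit) norm_minus_cancel norm_triangle_ineq4)
      moreover have "norm (?I ?a1 ?a2) \<le> (C * T1 powr (- \<delta>)) / l"
        using cont(1) elim(2) pos(3) bound[of _ "- T1"] T T'
        by (intro horizontal_contour_integral_bound) auto
      moreover have "?I ?a3 ?a4 = - ?I ?a4 ?a3"
        by (rule contour_integral_reverse_linepath[OF cont(3)])
      moreover have "norm (?I ?a4 ?a3) \<le> (C * T2 powr (- \<delta>)) / l"
        using cont(3) elim(2) pos(3) bound[of _ "T2"] T T'
        by (intro horizontal_contour_integral_bound) (auto simp: closed_segment_commute)
      moreover have "norm (?I ?a4 ?a1) \<le> e * norm (?a1 - ?a4)"
      proof (rule contour_integral_bound_linepath[OF ci(4)])
        fix w assume "w \<in> closed_segment ?a4 ?a1"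
        then have w: "Re w = - X n" "Im w \<in> {- T1..T2}"
          using T' by (auto simp: closed_segment_same_Re closed_segment_eq_real_ivl)
        then have "Im w \<in> {- max T1 T2..max T1 T2}"
          by auto
        with elim(1) have "norm (F (Complex (- X n) (Im w))) \<le> e"
          by blast
        with w(1) show "norm (F w) \<le> e"
          by (metis complex.collapse)
      qed (use e in auto)
      moreover have "norm (?a1 - ?a4) = T1 + T2"
        using T' by (simp add: cmod_def)
      moreover have "B = (C * T1 powr (- \<delta>)) / l + (C * T2 powr (- \<delta>)) / l"
        by (simp add: B_def algebra_simps)
      ultimately show ?case
        by simp
    qed
  qed auto
  then have "norm (J - 2 * pi * \<i> * S) \<le> B + e" if "e > 0" for e
    using that T' by (metis add_pos_pos divide_pos_pos nonzero_mult_div_cancel_right order_less_irrefl times_divide_eq_left)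
  then have "norm (J - 2 * pi * \<i> * S) \<le> B"
    by (rule field_le_epsilon)
  then show ?thesis
    unfolding J_def B_def .
qed

lemma imag_axis_has_integral:
  "((\<lambda>t::real. F (\<i> * of_real t) * \<i>) has_integral 2 * pi * \<i> * S) UNIV"
proof -
  let ?f = "\<lambda>t::real. F (\<i> * of_real t) * \<i>"
  have cont: "continuous_on UNIV ?f"
  proof (intro continuous_intros)
    have "h x \<noteq> \<i> * of_real t" if "x \<in> Q" for x t
      using Re_neg[OF that] by (auto simp: complex_eq_iff)
    then have "range (\<lambda>t. \<i> * of_real t) \<subseteq> U - h ` Q"
      using U(3) by (auto simp: image_iff subset_iff) metis
    then show "continuous_on UNIV (\<lambda>t. F (\<i> * of_real t))"
      by (intro continuous_on_compose2[OF holomorphic_on_imp_continuous_on[OF holo]] continuous_intros)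
  qed
  have "(\<exists>B>0. \<forall>a b. ball 0 B \<subseteq> cbox a b \<longrightarrow> norm (integral (cbox a b) ?f - 2 * pi * \<i> * S) < e)"
    if e: "e > 0" for e
  proof -
    have "((\<lambda>T. C / l * (T powr (- \<delta>) + T powr (- \<delta>))) \<longlongrightarrow> C / l * (0 + 0)) at_top"
      using pos by (intro tendsto_intros tendsto_neg_powr filterlim_ident) auto
    then have "eventually (\<lambda>T. C / l * (T powr (- \<delta>) + T powr (- \<delta>)) < e) at_top"
      using e by (intro order_tendstoD) auto
    then obtain B0 where B0: "\<And>T. T \<ge> B0 \<Longrightarrow> C / l * (T powr (- \<delta>) + T powr (- \<delta>)) < e"
      by (auto simp: eventually_at_top_linorder)
    define B where "B = max B0 T0"
    have "B > 0" "B \<ge> T0"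
      using pos by (auto simp: B_def)
    have "norm (integral (cbox a b) ?f - 2 * pi * \<i> * S) < e" if ab: "ball 0 B \<subseteq> cbox a b" for a b
    proof -
      \<comment> \<open>The ball is open; passing to its closure puts the endpoints B and -B
        themselves into the interval.\<close>
      have "cball 0 B \<subseteq> cbox a b"
        using closure_minimal[OF ab] \<open>B > 0\<close> by simp
      then have "B \<in> cbox a b" "- B \<in> cbox a b"
        by (rule subsetD, use \<open>B > 0\<close> in simp)+
      then have ab': "a \<le> - B" "B \<le> b"
        by auto
      have "norm (integral {- (- a)..b} ?f - 2 * pi * \<i> * S) \<le> C / l * ((- a) powr (- \<delta>) + b powr (- \<delta>))"
        by (rule integral_minus_residues_bound) (use ab' \<open>B \<ge> T0\<close> in auto)
      also have "\<dots> \<le> C / l * (B powr (- \<delta>) + B powr (- \<delta>))"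
        using ab' pos \<open>B > 0\<close> by (intro mult_left_mono add_mono powr_mono2') auto
      also have "\<dots> < e"
        using B0[of B] by (simp add: B_def)
      finally show ?thesis
        by simp
    qed
    with \<open>B > 0\<close> show ?thesis by blast
  qed
  then show ?thesis
    unfolding has_integral_alt'[where s = UNIV]
    using integrable_continuous[OF continuous_on_subset[OF cont]] by simp
qed

end

section \<open>The power function and ratios of products\<close>

lemma cpower_int_diff:
  assumes "z \<noteq> 0" and "a - a' = of_int n"
  shows "cpower z a a' = (z / of_real (norm z)) powi n * of_real (norm z) powr (a + a')"
  using assms by (simp add: cpower_def complex_powr_of_int)

text \<open>With w = z / |z| and r = |z|, one has z = w r and cnj z = r / w, so the extra factor
  w^(l - m) r^(l + m) splits into z^l (cnj z)^m.\<close>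

lemma cpower_shift:
  assumes "z \<noteq> 0" and "a - a' \<in> \<int>"
  shows "cpower z (a + of_nat l) (a' + of_nat m) = cpower z a a' * z ^ l * cnj z ^ m"
proof -
  from assms(2) obtain n where n: "a - a' = of_int n"
    by (auto elim!: Ints_cases)
  have n': "a + of_nat l - (a' + of_nat m) = of_int (n + int l - int m)"
    using n by (simp add: algebra_simps)
  define r where "r = complex_of_real (norm z)"
  define w where "w = z / r"
  have r: "r \<noteq> 0" and w: "w \<noteq> 0"
    using assms(1) by (auto simp: r_def w_def)
  have "r * r = z * cnj z"
    unfolding r_def using complex_norm_square[of z] by (simp add: power2_eq_square)
  then have cnj: "cnj z = inverse w * r"
    unfolding w_def using assms(1) r by (simp add: field_simps)
  have "w powi (n + int l - int m) = w powi n * w ^ l * inverse w ^ m"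
    using w by (simp add: power_int_add power_int_diff power_inverse divide_inverse)
  moreover have "r powr (a + of_nat l + (a' + of_nat m)) = r powr (a + a') * r ^ l * r ^ m"
  proof -
    have "a + of_nat l + (a' + of_nat m) = (a + a') + of_nat l + of_nat m"
      by simp
    then show ?thesis
      using r by (simp only: powr_add powr_nat) auto
  qed
  moreover have "z ^ l = w ^ l * r ^ l"
    using r by (simp add: w_def flip: power_mult_distrib)
  moreover have "cnj z ^ m = inverse w ^ m * r ^ m"
    by (simp add: cnj power_mult_distrib)
  ultimately show ?thesis
    unfolding cpower_int_diff[OF assms(1) n] cpower_int_diff[OF assms(1) n'] r_def[symmetric] w_def[symmetric]
    by (simp add: mult_ac)
qed

lemma prod_shift_asymptotics:
  fixes c :: "'i \<Rightarrow> complex"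
  assumes "finite I"
  shows "((\<lambda>w. (\<Prod>i\<in>I. w + c i) / w ^ card I) \<longlongrightarrow> 1) at_infinity"
proof -
  have "((\<lambda>w. 1 + c i / w) \<longlongrightarrow> 1 + 0) at_infinity" for i
    by (intro tendsto_intros tendsto_divide_0[OF tendsto_const] filterlim_ident)
  then have "((\<lambda>w. \<Prod>i\<in>I. 1 + c i / w) \<longlongrightarrow> (\<Prod>i\<in>I. 1)) at_infinity"
    by (intro tendsto_prod) simp
  moreover have "eventually (\<lambda>w. (\<Prod>i\<in>I. 1 + c i / w) = (\<Prod>i\<in>I. w + c i) / w ^ card I) at_infinity"
    unfolding eventually_at_infinity
  proof (intro exI allI impI)
    fix w :: complex assume "1 \<le> norm w"
    then have "w \<noteq> 0"
      by auto
    then have "(\<Prod>i\<in>I. 1 + c i / w) = (\<Prod>i\<in>I. (w + c i) / w)"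
      by (intro prod.cong) (auto simp: field_simps)
    then show "(\<Prod>i\<in>I. 1 + c i / w) = (\<Prod>i\<in>I. w + c i) / w ^ card I"
      by (simp add: prod_dividef)
  qed
  ultimately show ?thesis
    by (simp add: tendsto_cong)
qed

text \<open>This limit is used twice: for the rational factor by which the integrand changes under
  the shift, and for the ratio of consecutive hypergeometric terms.\<close>

lemma prod_ratio_asymptotics:
  fixes c :: "'i \<Rightarrow> complex" and d :: "'j \<Rightarrow> complex"
  assumes "finite I" "finite J" "card I \<le> card J"
  shows "((\<lambda>w. (\<Prod>i\<in>I. w + c i) / (\<Prod>j\<in>J. w + d j)) \<longlongrightarrow> (if card I = card J then 1 else 0)) at_infinity"
proof -
  define n where "n = card J - card I"
  have "((\<lambda>w::complex. inverse w ^ n) \<longlongrightarrow> 0 ^ n) at_infinity"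
    by (intro tendsto_intros tendsto_inverse_0)
  then have "((\<lambda>w. ((\<Prod>i\<in>I. w + c i) / w ^ card I) / ((\<Prod>j\<in>J. w + d j) / w ^ card J) * inverse w ^ n)
           \<longlongrightarrow> 1 / 1 * 0 ^ n) at_infinity"
    by (intro tendsto_mult tendsto_divide prod_shift_asymptotics assms) auto
  also have "1 / 1 * 0 ^ n = (if card I = card J then 1 else 0 :: complex)"
    using assms(3) by (auto simp: n_def)
  finally show ?thesis
  proof (rule Lim_transform_eventually)
    show "eventually (\<lambda>w. ((\<Prod>i\<in>I. w + c i) / w ^ card I) / ((\<Prod>j\<in>J. w + d j) / w ^ card J) * inverse w ^ n
             = (\<Prod>i\<in>I. w + c i) / (\<Prod>j\<in>J. w + d j)) at_infinity"
      unfolding eventually_at_infinity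
    proof (intro exI allI impI)
      fix w :: complex assume "1 \<le> norm w"
      then have "w \<noteq> 0"
        by auto
      moreover have "w ^ card J = w ^ card I * w ^ n"
        using assms(3) by (simp add: n_def flip: power_add)
      ultimately show "((\<Prod>i\<in>I. w + c i) / w ^ card I) / ((\<Prod>j\<in>J. w + d j) / w ^ card J) * inverse w ^ n
             = (\<Prod>i\<in>I. w + c i) / (\<Prod>j\<in>J. w + d j)"
        by (simp add: field_simps)
    qed
  qed
qed

section \<open>Growth of the kernel\<close>

text \<open>The strip is one period of the shift by 2. The exponent may depend on the real part x
  because each Gamma factor grows like a power of |y| that is affine in x.\<close>

definition strip_bounded :: "(complex \<Rightarrow> complex) \<Rightarrow> (real \<Rightarrow> real) \<Rightarrow> bool" where
  "strip_bounded f e \<longleftrightarrow> (\<exists>C>0. \<exists>T>0. \<forall>x\<in>{-2..0}. \<forall>y. \<bar>y\<bar> \<ge> T \<longrightarrow>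
      norm (f (Complex x y)) \<le> C * \<bar>y\<bar> powr e x)"

lemma strip_bounded_mult:
  assumes "strip_bounded f e" "strip_bounded g e'"
  shows "strip_bounded (\<lambda>s. f s * g s) (\<lambda>x. e x + e' x)"
proof -
  from assms obtain C T C' T' where *: "C > 0" "T > 0" "C' > 0" "T' > 0"
    "\<And>x y. x \<in> {-2..0} \<Longrightarrow> \<bar>y\<bar> \<ge> T \<Longrightarrow> norm (f (Complex x y)) \<le> C * \<bar>y\<bar> powr e x"
    "\<And>x y. x \<in> {-2..0} \<Longrightarrow> \<bar>y\<bar> \<ge> T' \<Longrightarrow> norm (g (Complex x y)) \<le> C' * \<bar>y\<bar> powr e' x"
    unfolding strip_bounded_def by metis
  have "norm (f (Complex x y) * g (Complex x y)) \<le> (C * C') * \<bar>y\<bar> powr (e x + e' x)"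
    if "x \<in> {-2..0}" "\<bar>y\<bar> \<ge> max T T'" for x y
  proof -
    have "norm (f (Complex x y) * g (Complex x y)) \<le> (C * \<bar>y\<bar> powr e x) * (C' * \<bar>y\<bar> powr e' x)"
      unfolding norm_mult using that * by (intro mult_mono) auto
    then show ?thesis
      by (simp add: powr_add mult_ac)
  qed
  moreover have "C * C' > 0" "max T T' > 0"
    using * by auto
  ultimately show ?thesis
    unfolding strip_bounded_def by blast
qed

lemma strip_bounded_const:
  assumes "\<And>x y. x \<in> {-2..0} \<Longrightarrow> norm (f (Complex x y)) \<le> M"
  shows "strip_bounded f (\<lambda>_. 0)"
  unfolding strip_bounded_def
proof (intro exI conjI ballI allI impI)
  fix x y :: real assume xy: "x \<in> {-2..0}" "\<bar>y\<bar> \<ge> 1"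
  have "y \<noteq> 0"
    using xy(2) by auto
  then show "norm (f (Complex x y)) \<le> (\<bar>M\<bar> + 1) * \<bar>y\<bar> powr 0"
    using assms[OF xy(1), of y] by simp
qed auto

lemma strip_bounded_prod:
  assumes "finite I" "\<And>i. i \<in> I \<Longrightarrow> strip_bounded (f i) (e i)"
  shows "strip_bounded (\<lambda>s. \<Prod>i\<in>I. f i s) (\<lambda>x. \<Sum>i\<in>I. e i x)"
  using assms
proof (induction I rule: finite_induct)
  case empty
  then show ?case
    using strip_bounded_const[of "\<lambda>_. 1" 1] by simp
next
  case (insert i I)
  then show ?case
    using strip_bounded_mult[of "f i" "e i" "\<lambda>s. \<Prod>i\<in>I. f i s" "\<lambda>x. \<Sum>i\<in>I. e i x"] by simp
qed

text \<open>The imaginary part of a Gamma argument is only comparable to that of \<sigma>. For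
  positive exponents the upper comparison suffices, for negative ones the lower one, at the cost of
  a power of \<open>K\<close>.\<close>

lemma powr_le_of_comparable:
  fixes y Y e K :: real
  assumes "y > 0" "K \<ge> 1" "y / K \<le> Y" "Y \<le> y"
  shows "Y powr e \<le> K powr \<bar>e\<bar> * y powr e"
proof (cases "e \<ge> 0")
  case True
  have "Y > 0"
    using assms by (smt (verit) divide_pos_pos)
  then have "Y powr e \<le> y powr e"
    using assms True by (intro powr_mono2) auto
  moreover have "1 \<le> K powr \<bar>e\<bar>"
    using assms True by (simp add: ge_one_powr_ge_zero)
  ultimately show ?thesis
    by (smt (verit) mult_le_cancel_right1 powr_ge_zero)
next
  case False
  have "Y powr e \<le> (y / K) powr e"
    using assms False by (intro powr_mono2') auto
  also have "\<dots> = K powr \<bar>e\<bar> * y powr e"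
    using assms False by (simp add: powr_divide powr_minus field_simps)
  finally show ?thesis .
qed

text \<open>
  As \<open>a - a'\<close> is an integer, \<open>a + s\<close> and \<open>cnj (1 - a' - s)\<close> have the same imaginary part, so that the
  quotient of Gamma functions is covered by \<open>Gamma_ratio_on_strip\<close>.
\<close>

lemma GammaC_strip_bounded:
  assumes "a - a' \<in> \<int>" and eps: "\<epsilon> = 1 \<or> \<epsilon> = (- 1 :: real)"
  shows "strip_bounded (\<lambda>\<sigma>. GammaC (a + of_real \<epsilon> * \<sigma> / 2) (a' + of_real \<epsilon> * \<sigma> / 2))
           (\<lambda>x. Re (a + a') + \<epsilon> * x - 1)"
proof -
  from assms obtain i where "a - a' = of_int i"
    by (auto elim!: Ints_cases)
  then have Im_eq: "Im a' = Im a"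
    by (auto simp: complex_eq_iff)
  \<comment> \<open>For x in [-2, 0] the half-shift is at most 1 in modulus, so \<open>R\<close>
    bounds the real parts of both Gamma arguments, and 2 R bounds their difference, the
    exponent.\<close>
  define R where "R = \<bar>Re a\<bar> + \<bar>Re a'\<bar> + 2"
  obtain C where C: "C > 0"
    "\<And>x x' y. x \<in> {-R..R} \<Longrightarrow> x' \<in> {-R..R} \<Longrightarrow> \<bar>y\<bar> \<ge> 1 \<Longrightarrow>
       norm (Gamma (Complex x y)) \<le> C * \<bar>y\<bar> powr (x - x') * norm (Gamma (Complex x' y))"
    using Gamma_ratio_on_strip by blast
  \<comment> \<open>Above this height Im a is small against y / 2, so that \<open>Y\<close> lies
    between |y| / 4 and |y| in modulus and is at least 1 in modulus.\<close>
  define T where "T = 4 * (\<bar>Im a\<bar> + 1)"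
  have "norm (GammaC (a + of_real \<epsilon> * Complex x y / 2) (a' + of_real \<epsilon> * Complex x y / 2)) \<le>
          (C * 4 powr (2 * R)) * \<bar>y\<bar> powr (Re (a + a') + \<epsilon> * x - 1)"
    if xy: "x \<in> {-2..0}" "\<bar>y\<bar> \<ge> T" for x y
  proof -
    define s where "s = of_real \<epsilon> * Complex x y / 2"
    define X where "X = Re (a + s)"
    define X' where "X' = Re (1 - (a' + s))"
    define Y where "Y = Im (a + s)"
    define e where "e = Re (a + a') + \<epsilon> * x - 1"
    have s: "Re s = \<epsilon> * x / 2" "Im s = \<epsilon> * y / 2"
      by (auto simp: s_def)
    have XX: "X = Re a + \<epsilon> * x / 2" "X' = 1 - Re a' - \<epsilon> * x / 2" "Y = Im a + \<epsilon> * y / 2"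
      by (auto simp: X_def X'_def Y_def s)
    have num: "a + s = Complex X Y"
      by (simp add: X_def Y_def complex_eq_iff)
    have den: "1 - (a' + s) = cnj (Complex X' Y)"
      by (simp add: X'_def Y_def complex_eq_iff Im_eq)
    have Y: "\<bar>y\<bar> / 4 \<le> \<bar>Y\<bar>" "\<bar>Y\<bar> \<le> \<bar>y\<bar>" "\<bar>Y\<bar> \<ge> 1" "y \<noteq> 0"
    proof -
      have y: "4 * \<bar>Im a\<bar> + 4 \<le> \<bar>y\<bar>"
        using xy(2) by (simp add: T_def)
      have "\<bar>\<epsilon> * y / 2\<bar> = \<bar>y\<bar> / 2"
        using eps by auto
      then have "\<bar>y\<bar> / 2 - \<bar>Im a\<bar> \<le> \<bar>Y\<bar>" "\<bar>Y\<bar> \<le> \<bar>y\<bar> / 2 + \<bar>Im a\<bar>"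
        unfolding XX by linarith+
      with y show "\<bar>y\<bar> / 4 \<le> \<bar>Y\<bar>" "\<bar>Y\<bar> \<le> \<bar>y\<bar>" "\<bar>Y\<bar> \<ge> 1" "y \<noteq> 0"
        by linarith+
    qed
    have XR: "X \<in> {-R..R}" "X' \<in> {-R..R}" "\<bar>e\<bar> \<le> 2 * R"
      using xy(1) eps unfolding XX R_def e_def by auto
    have e: "X - X' = e"
      unfolding XX e_def by (simp add: field_simps)
    have "Y \<noteq> 0"
      using Y by auto
    note nonpole = Complex_notin_nonpos_Ints[OF this]
    have "norm (GammaC (a + s) (a' + s)) = norm (Gamma (Complex X Y)) / norm (Gamma (Complex X' Y))"
      using nonpole[of X] by (simp add: GammaC_eq num den norm_divide flip: cnj_Gamma)
    also have "\<dots> \<le> C * \<bar>Y\<bar> powr e"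
    proof -
      from nonpole[of X'] have "norm (Gamma (Complex X' Y)) > 0"
        by (simp add: Gamma_eq_zero_iff)
      then show ?thesis
        using C(2)[OF XR(1,2) Y(3)] by (simp add: e divide_le_eq)
    qed
    also have "\<dots> \<le> C * (4 powr (2 * R) * \<bar>y\<bar> powr e)"
    proof -
      have "\<bar>Y\<bar> powr e \<le> 4 powr \<bar>e\<bar> * \<bar>y\<bar> powr e"
        using Y by (intro powr_le_of_comparable) auto
      also have "\<dots> \<le> 4 powr (2 * R) * \<bar>y\<bar> powr e"
        using XR(3) by (intro mult_right_mono powr_mono) auto
      finally show ?thesis
        using C(1) by simp
    qed
    finally show ?thesis
      unfolding s_def e_def by (simp only: mult.assoc)
  qed
  moreover have "C * 4 powr (2 * R) > 0" "T > 0"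
    using C(1) by (auto simp: T_def)
  ultimately show ?thesis
    unfolding strip_bounded_def by blast
qed

section \<open>The integrand for one Fourier mode\<close>

text \<open>\<open>direction\<close> collects the two cases in which the contour can be closed to
  the left. The other two cases are instances of this locale with the families exchanged and z
  inverted.\<close>

locale meijer_left =
  fixes p q :: nat and a a' b b' :: "nat \<Rightarrow> complex" and z :: complex
  assumes a_Lambda: "\<And>\<alpha>. \<alpha> \<in> {1..q} \<Longrightarrow> a \<alpha> - a' \<alpha> \<in> \<int>"
    and b_Lambda: "\<And>\<beta>. \<beta> \<in> {1..p} \<Longrightarrow> b \<beta> - b' \<beta> \<in> \<int>"
    and a_pos: "\<And>\<alpha>. \<alpha> \<in> {1..q} \<Longrightarrow> Re (a \<alpha> + a' \<alpha>) > 0"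
    and b_pos: "\<And>\<beta>. \<beta> \<in> {1..p} \<Longrightarrow> Re (b \<beta> + b' \<beta>) > 0"
    and sum_less: "(\<Sum>\<alpha>=1..q. Re (a \<alpha> + a' \<alpha>)) + (\<Sum>\<beta>=1..p. Re (b \<beta> + b' \<beta>)) < real (p + q)"
    and z_nz: "z \<noteq> 0"
    and direction: "p < q \<or> p = q \<and> norm z < 1"
    and nonresonant: "\<And>j \<alpha>. j \<in> {1..q} \<Longrightarrow> \<alpha> \<in> {1..q} - {j} \<Longrightarrow> a \<alpha> - a j \<notin> \<int>"
begin

abbreviation F :: "int \<Rightarrow> complex \<Rightarrow> complex" where
  "F \<equiv> integrandC p q a a' b b' z"

definition pole_set :: "int \<Rightarrow> complex set" where
  "pole_set k = {\<sigma>. \<exists>j\<in>{1..q}. GammaC_pole (a j + (of_int k + \<sigma>) / 2) (a' j + (- of_int k + \<sigma>) / 2)}"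

text \<open>An open half-plane (or the whole plane, if p = 0) that contains the closed left
  half-plane and none of the poles of the b-factors; inside it only the a-factors can be
  singular.\<close>

definition b_halfplane :: "complex set" where
  "b_halfplane = {\<sigma>. \<forall>\<beta>\<in>{1..p}. Re \<sigma> < Re (b \<beta> + b' \<beta>)}"

definition \<delta> :: real where
  "\<delta> = real (p + q) - (\<Sum>\<alpha>=1..q. Re (a \<alpha> + a' \<alpha>)) - (\<Sum>\<beta>=1..p. Re (b \<beta> + b' \<beta>))"

lemma \<delta>_pos: "\<delta> > 0"
  using sum_less by (simp add: \<delta>_def)

lemma a_diff: "\<alpha> \<in> {1..q} \<Longrightarrow> a \<alpha> + (of_int k + \<sigma>) / 2 - (a' \<alpha> + (- of_int k + \<sigma>) / 2) \<in> \<int>"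
  using Ints_add[OF a_Lambda Ints_of_int[of k]]
  by (simp add: add_divide_distrib diff_divide_distrib algebra_simps)

lemma b_diff: "\<beta> \<in> {1..p} \<Longrightarrow> b \<beta> + (- of_int k - \<sigma>) / 2 - (b' \<beta> + (of_int k - \<sigma>) / 2) \<in> \<int>"
  using Ints_diff[OF b_Lambda Ints_of_int[of k]]
  by (simp add: add_divide_distrib diff_divide_distrib algebra_simps)

lemma b_no_pole:
  assumes "\<sigma> \<in> b_halfplane" "\<beta> \<in> {1..p}"
  shows "\<not> GammaC_pole (b \<beta> + (- of_int k - \<sigma>) / 2) (b' \<beta> + (of_int k - \<sigma>) / 2)"
proof
  assume "GammaC_pole (b \<beta> + (- of_int k - \<sigma>) / 2) (b' \<beta> + (of_int k - \<sigma>) / 2)"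
  from GammaC_pole_imp_Re_le[OF this] have "Re (b \<beta> + b' \<beta>) \<le> Re \<sigma>"
    by (simp add: field_simps)
  moreover have "Re \<sigma> < Re (b \<beta> + b' \<beta>)"
    using assms unfolding b_halfplane_def by blast
  ultimately show False
    by linarith
qed

lemma Re_nonpos_in_b_halfplane: "Re \<sigma> \<le> 0 \<Longrightarrow> \<sigma> \<in> b_halfplane"
  using b_pos by (fastforce simp: b_halfplane_def)

lemma b_halfplane_convex: "open b_halfplane" "convex b_halfplane"
proof -
  have *: "b_halfplane = (\<Inter>\<beta>\<in>{1..p}. {\<sigma>. Re \<sigma> < Re (b \<beta> + b' \<beta>)})"
    by (auto simp: b_halfplane_def)
  show "open b_halfplane" "convex b_halfplane"
    unfolding * by (auto intro!: convex_INT open_halfspace_Re_lt convex_halfspace_Re_lt simp del: plus_complex.sel)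
qed

lemma cpower_integrand:
  "cpower z ((- of_int k - \<sigma>) / 2) ((of_int k - \<sigma>) / 2) =
     (z / of_real (norm z)) powi (- k) * of_real (norm z) powr (- \<sigma>)"
proof -
  have "(- of_int k - \<sigma>) / 2 - (of_int k - \<sigma>) / 2 = of_int (- k)"
    "(- of_int k - \<sigma>) / 2 + (of_int k - \<sigma>) / 2 = - \<sigma>"
    by (simp_all add: field_simps)
  then show ?thesis
    using cpower_int_diff[OF z_nz] by metis
qed

lemma norm_cpower_integrand:
  "norm (cpower z ((- of_int k - \<sigma>) / 2) ((of_int k - \<sigma>) / 2)) = norm z powr (- Re \<sigma>)"
  using z_nz unfolding cpower_integrand
  by (simp add: norm_mult norm_power_int norm_divide norm_powr_real_powr)

lemma GammaC_factor_holomorphic: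
  assumes "u - u' \<in> \<int>" "c \<noteq> 0"
    and "\<And>\<sigma>. \<sigma> \<in> V \<Longrightarrow> \<not> GammaC_pole (u + c * \<sigma>) (u' + c * \<sigma>)"
  shows "(\<lambda>\<sigma>. GammaC (u + c * \<sigma>) (u' + c * \<sigma>)) holomorphic_on V"
  using holomorphic_on_compose_gen[OF _ GammaC_holomorphic[OF assms(1)], of "\<lambda>\<sigma>. c * \<sigma>" V] assms(3)
  by (auto simp: o_def intro!: holomorphic_intros)

lemma a_factor_holomorphic:
  assumes "\<alpha> \<in> {1..q}"
    and "\<And>\<sigma>. \<sigma> \<in> V \<Longrightarrow> \<not> GammaC_pole (a \<alpha> + (of_int k + \<sigma>) / 2) (a' \<alpha> + (- of_int k + \<sigma>) / 2)"
  shows "(\<lambda>\<sigma>. GammaC (a \<alpha> + (of_int k + \<sigma>) / 2) (a' \<alpha> + (- of_int k + \<sigma>) / 2)) holomorphic_on V"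
proof -
  have eq: "a \<alpha> + (of_int k + \<sigma>) / 2 = a \<alpha> + of_int k / 2 + 1 / 2 * \<sigma>"
    "a' \<alpha> + (- of_int k + \<sigma>) / 2 = a' \<alpha> - of_int k / 2 + 1 / 2 * \<sigma>" for \<sigma>
    by (simp_all add: field_simps)
  show ?thesis
    using assms(2) a_diff[OF assms(1), of k 0] unfolding eq
    by (intro GammaC_factor_holomorphic) auto
qed

lemma b_factor_holomorphic:
  assumes "\<beta> \<in> {1..p}" "V \<subseteq> b_halfplane"
  shows "(\<lambda>\<sigma>. GammaC (b \<beta> + (- of_int k - \<sigma>) / 2) (b' \<beta> + (of_int k - \<sigma>) / 2)) holomorphic_on V"
proof -
  have eq: "b \<beta> + (- of_int k - \<sigma>) / 2 = b \<beta> - of_int k / 2 + (- 1 / 2) * \<sigma>"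
    "b' \<beta> + (of_int k - \<sigma>) / 2 = b' \<beta> + of_int k / 2 + (- 1 / 2) * \<sigma>" for \<sigma>
    by (simp_all add: field_simps)
  show ?thesis
    using b_no_pole[OF subsetD[OF assms(2)] assms(1), of _ k] b_diff[OF assms(1), of k 0] unfolding eq
    by (intro GammaC_factor_holomorphic) auto
qed

lemma cpower_integrand_holomorphic:
  "(\<lambda>\<sigma>. cpower z ((- of_int k - \<sigma>) / 2) ((of_int k - \<sigma>) / 2)) holomorphic_on V"
  unfolding cpower_integrand by (intro holomorphic_intros) (use z_nz in auto)

lemma F_holomorphic: "F k holomorphic_on b_halfplane - pole_set k"
  unfolding integrandC_def[abs_def] kernelC_def
  by (intro holomorphic_on_mult holomorphic_on_prod cpower_integrand_holomorphic
        a_factor_holomorphic b_factor_holomorphic) (auto simp: pole_set_def)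

text \<open>Each a-factor has exponent Re(a + a') + x - 1 and each b-factor Re(b + b') - x - 1,
  while the power of z is bounded on the strip. Adding up, the constants -1 produce -(p + q) and
  hence -\<delta>.\<close>

lemma F_strip_bounded: "strip_bounded (F k) (\<lambda>x. - \<delta> + (real q - real p) * x)"
proof -
  have A: "strip_bounded (\<lambda>\<sigma>. GammaC (a \<alpha> + (of_int k + \<sigma>) / 2) (a' \<alpha> + (- of_int k + \<sigma>) / 2))
             (\<lambda>x. Re (a \<alpha> + a' \<alpha>) + x - 1)" if "\<alpha> \<in> {1..q}" for \<alpha>
  proof -
    have "a \<alpha> + of_int k / 2 - (a' \<alpha> - of_int k / 2) \<in> \<int>"
      using a_diff[OF that, of k 0] by simp
    from GammaC_strip_bounded[OF this, of 1] show ?thesis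
      by (simp add: add_divide_distrib diff_divide_distrib algebra_simps)
  qed
  have B: "strip_bounded (\<lambda>\<sigma>. GammaC (b \<beta> + (- of_int k - \<sigma>) / 2) (b' \<beta> + (of_int k - \<sigma>) / 2))
             (\<lambda>x. Re (b \<beta> + b' \<beta>) - x - 1)" if "\<beta> \<in> {1..p}" for \<beta>
  proof -
    have "b \<beta> - of_int k / 2 - (b' \<beta> + of_int k / 2) \<in> \<int>"
      using b_diff[OF that, of k 0] by simp
    from GammaC_strip_bounded[OF this, of "-1"] show ?thesis
      by (simp add: add_divide_distrib diff_divide_distrib algebra_simps)
  qed
  have "norm (cpower z ((- of_int k - Complex x y) / 2) ((of_int k - Complex x y) / 2))
          \<le> (norm z + 1) powr 2" if "x \<in> {-2..0}" for x y
  proof -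
    have "norm z powr (- x) \<le> (norm z + 1) powr (- x)"
      using that by (intro powr_mono2) auto
    also have "\<dots> \<le> (norm z + 1) powr 2"
      using that by (intro powr_mono) auto
    finally show ?thesis
      unfolding norm_cpower_integrand by simp
  qed
  then have Z: "strip_bounded (\<lambda>\<sigma>. cpower z ((- of_int k - \<sigma>) / 2) ((of_int k - \<sigma>) / 2)) (\<lambda>_. 0)"
    by (rule strip_bounded_const)
  have "strip_bounded (F k)
     (\<lambda>x. (\<Sum>\<alpha>=1..q. Re (a \<alpha> + a' \<alpha>) + x - 1) + (\<Sum>\<beta>=1..p. Re (b \<beta> + b' \<beta>) - x - 1) + 0)"
    unfolding integrandC_def[abs_def] kernelC_def
    by (intro strip_bounded_mult strip_bounded_prod A B Z) auto
  also have "(\<lambda>x. (\<Sum>\<alpha>=1..q. Re (a \<alpha> + a' \<alpha>) + x - 1) + (\<Sum>\<beta>=1..p. Re (b \<beta> + b' \<beta>) - x - 1) + 0)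
          = (\<lambda>x. - \<delta> + (real q - real p) * x)"
    by (simp add: \<delta>_def sum.distrib sum_subtractf algebra_simps)
  finally show ?thesis .
qed

text \<open>
  Shifting \<open>\<sigma>\<close> by \<open>-2\<close> multiplies the integrand by a rational function, whose modulus has limit
  \<open>0\<close> at infinity if \<open>p < q\<close>, and \<open>norm z ^ 2\<close> if \<open>p = q\<close>.
\<close>

lemma F_shift_contracts:
  obtains \<rho> B where "0 < \<rho>" "\<rho> < 1"
    "\<And>\<sigma>. norm \<sigma> \<ge> B \<Longrightarrow> Re \<sigma> \<le> 0 \<Longrightarrow> \<sigma> - 2 \<notin> pole_set k \<Longrightarrow> norm (F k (\<sigma> - 2)) \<le> \<rho> * norm (F k \<sigma>)"
proof -
  \<comment> \<open>With w = \<sigma> / 2, the factors w + d and w + d' are the two arguments of an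
    a-factor at \<sigma> - 2, and w + c and w + c' are the negatives of the two arguments of a
    b-factor at \<sigma>. These are exactly the factors that the recurrences produce.\<close>
  define c where "c \<beta> = of_int k / 2 - b \<beta>" for \<beta>
  define c' where "c' \<beta> = - of_int k / 2 - b' \<beta>" for \<beta>
  define d where "d \<alpha> = a \<alpha> + of_int k / 2 - 1" for \<alpha>
  define d' where "d' \<alpha> = a' \<alpha> - of_int k / 2 - 1" for \<alpha>
  define P where "P w = (\<Prod>\<beta>=1..p. w + c \<beta>)" for w
  define P' where "P' w = (\<Prod>\<beta>=1..p. w + c' \<beta>)" for w
  define D where "D w = (\<Prod>\<alpha>=1..q. w + d \<alpha>)" for w
  define D' where "D' w = (\<Prod>\<alpha>=1..q. w + d' \<alpha>)" for w
  define L where "L = (norm z)\<^sup>2 * (if p = q then 1 else 0)"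
  have "p \<le> q"
    using direction by auto
  have "((\<lambda>w. (norm z)\<^sup>2 * norm (P w / D w * (P' w / D' w))) \<longlongrightarrow>
         (norm z)\<^sup>2 * norm ((if card {1..p} = card {1..q} then 1 else 0) *
                (if card {1..p} = card {1..q} then 1 else 0) :: complex)) at_infinity"
    unfolding P_def D_def P'_def D'_def
    by (intro tendsto_intros prod_ratio_asymptotics) (use \<open>p \<le> q\<close> in auto)
  also have "(norm z)\<^sup>2 * norm ((if card {1..p} = card {1..q} then 1 else 0) *
                (if card {1..p} = card {1..q} then 1 else 0) :: complex) = L"
    by (simp add: L_def)
  finally have lim: "((\<lambda>w. (norm z)\<^sup>2 * norm (P w / D w * (P' w / D' w))) \<longlongrightarrow> L) at_infinity" .
  have "L < 1" "L \<ge> 0"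
    using direction by (auto simp: L_def power_less_one_iff)
  then obtain \<rho> where \<rho>: "L < \<rho>" "0 < \<rho>" "\<rho> < 1"
    using dense[of L 1] by auto
  have "eventually (\<lambda>w. \<forall>\<alpha>\<in>{1..q}. w + d \<alpha> \<noteq> 0 \<and> w + d' \<alpha> \<noteq> 0) at_infinity"
  proof (intro eventually_ball_finite ballI)
    fix \<alpha>
    show "eventually (\<lambda>w. w + d \<alpha> \<noteq> 0 \<and> w + d' \<alpha> \<noteq> 0) at_infinity"
      unfolding eventually_at_infinity
    proof (intro exI allI impI)
      fix w :: complex assume w: "norm (d \<alpha>) + norm (d' \<alpha>) + 1 \<le> norm w"
      have "w \<noteq> - u" if "norm u < norm w" for u
        using that by auto
      from this[of "d \<alpha>"] this[of "d' \<alpha>"] show "w + d \<alpha> \<noteq> 0 \<and> w + d' \<alpha> \<noteq> 0"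
        using w norm_ge_zero[of "d \<alpha>"] norm_ge_zero[of "d' \<alpha>"]
        by (auto simp: eq_neg_iff_add_eq_0)
    qed
  qed simp
  with order_tendstoD(2)[OF lim \<rho>(1)]
  have "eventually (\<lambda>w. (\<forall>\<alpha>\<in>{1..q}. w + d \<alpha> \<noteq> 0 \<and> w + d' \<alpha> \<noteq> 0) \<and>
           (norm z)\<^sup>2 * norm (P w / D w * (P' w / D' w)) < \<rho>) at_infinity"
    by eventually_elim auto
  then obtain B where B: "\<And>w. norm w \<ge> B \<Longrightarrow> (\<forall>\<alpha>\<in>{1..q}. w + d \<alpha> \<noteq> 0 \<and> w + d' \<alpha> \<noteq> 0) \<and>
           (norm z)\<^sup>2 * norm (P w / D w * (P' w / D' w)) < \<rho>"
    unfolding eventually_at_infinity by auto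
  have "norm (F k (\<sigma> - 2)) \<le> \<rho> * norm (F k \<sigma>)"
    if \<sigma>: "norm \<sigma> \<ge> 2 * B" "Re \<sigma> \<le> 0" "\<sigma> - 2 \<notin> pole_set k" for \<sigma>
  proof -
    define w where "w = \<sigma> / 2"
    have "norm w \<ge> B"
      using \<sigma>(1) by (simp add: w_def norm_divide)
    from B[OF this] have nz: "D w \<noteq> 0" "D' w \<noteq> 0"
      and small: "(norm z)\<^sup>2 * norm (P w / D w * (P' w / D' w)) < \<rho>"
      by (auto simp: D_def D'_def)
    define Ga where "Ga \<sigma> = (\<Prod>\<alpha>=1..q. GammaC (a \<alpha> + (of_int k + \<sigma>) / 2) (a' \<alpha> + (- of_int k + \<sigma>) / 2))" for \<sigma>
    define Gb where "Gb \<sigma> = (\<Prod>\<beta>=1..p. GammaC (b \<beta> + (- of_int k - \<sigma>) / 2) (b' \<beta> + (of_int k - \<sigma>) / 2))" for \<sigma>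
    define Z where "Z \<sigma> = cpower z ((- of_int k - \<sigma>) / 2) ((of_int k - \<sigma>) / 2)" for \<sigma>
    have F: "F k \<sigma> = Ga \<sigma> * Gb \<sigma> * Z \<sigma>" for \<sigma>
      by (simp add: integrandC_def kernelC_def Ga_def Gb_def Z_def)
    have "GammaC (a \<alpha> + (of_int k + \<sigma>) / 2) (a' \<alpha> + (- of_int k + \<sigma>) / 2) =
            - ((w + d \<alpha>) * (w + d' \<alpha>)) *
            GammaC (a \<alpha> + (of_int k + (\<sigma> - 2)) / 2) (a' \<alpha> + (- of_int k + (\<sigma> - 2)) / 2)"
      if "\<alpha> \<in> {1..q}" for \<alpha>
    proof -
      have "\<not> GammaC_pole (a \<alpha> + (of_int k + (\<sigma> - 2)) / 2) (a' \<alpha> + (- of_int k + (\<sigma> - 2)) / 2)"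
        using \<sigma>(3) that by (auto simp: pole_set_def)
      from GammaC_shift[OF this a_diff[OF that, of k "\<sigma> - 2"], of 1 1] show ?thesis
        by (simp add: w_def d_def d'_def field_simps)
    qed
    then have "norm (Ga \<sigma>) = norm (\<Prod>\<alpha>=1..q. - ((w + d \<alpha>) * (w + d' \<alpha>)) *
            GammaC (a \<alpha> + (of_int k + (\<sigma> - 2)) / 2) (a' \<alpha> + (- of_int k + (\<sigma> - 2)) / 2))"
      unfolding Ga_def by (intro arg_cong[where f = norm] prod.cong) auto
    then have 1: "norm (Ga \<sigma>) = norm (D w) * norm (D' w) * norm (Ga (\<sigma> - 2))"
      by (simp add: Ga_def D_def D'_def norm_mult prod.distrib prod_norm[symmetric])
    have "GammaC (b \<beta> + (- of_int k - (\<sigma> - 2)) / 2) (b' \<beta> + (of_int k - (\<sigma> - 2)) / 2) =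
            - ((w + c \<beta>) * (w + c' \<beta>)) *
            GammaC (b \<beta> + (- of_int k - \<sigma>) / 2) (b' \<beta> + (of_int k - \<sigma>) / 2)"
      if "\<beta> \<in> {1..p}" for \<beta>
      using GammaC_shift[OF b_no_pole[OF Re_nonpos_in_b_halfplane[OF \<sigma>(2)] that] b_diff[OF that, of k \<sigma>], of 1 1]
      by (simp add: w_def c_def c'_def field_simps)
    then have "norm (Gb (\<sigma> - 2)) = norm (\<Prod>\<beta>=1..p. - ((w + c \<beta>) * (w + c' \<beta>)) *
            GammaC (b \<beta> + (- of_int k - \<sigma>) / 2) (b' \<beta> + (of_int k - \<sigma>) / 2))"
      unfolding Gb_def by (intro arg_cong[where f = norm] prod.cong) auto
    then have 2: "norm (Gb (\<sigma> - 2)) = norm (P w) * norm (P' w) * norm (Gb \<sigma>)"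
      by (simp add: Gb_def P_def P'_def norm_mult prod.distrib prod_norm[symmetric])
    have "norm z powr (- Re (\<sigma> - 2)) = norm z powr (- Re \<sigma> + 2)"
      by (simp add: algebra_simps)
    also have "\<dots> = (norm z)\<^sup>2 * norm z powr (- Re \<sigma>)"
      using z_nz by (simp only: powr_add) simp
    finally have 3: "norm (Z (\<sigma> - 2)) = (norm z)\<^sup>2 * norm (Z \<sigma>)"
      unfolding Z_def norm_cpower_integrand .
    have "norm (F k (\<sigma> - 2)) =
        ((norm z)\<^sup>2 * norm (P w / D w * (P' w / D' w))) * norm (F k \<sigma>)"
      unfolding F norm_mult norm_divide 1 2 3 using nz by (simp add: field_simps)
    also have "\<dots> \<le> \<rho> * norm (F k \<sigma>)"
      using small by (intro mult_right_mono) auto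
    finally show ?thesis .
  qed
  then show ?thesis
    using \<rho> that by blast
qed

section \<open>Location of the poles and exponential decay to the left\<close>

text \<open>A strict bound for |Im \<sigma>| at all poles, the same for every k. The summand 1 makes
  it strict and also ensures |y| >= 1 beyond it, where powers of |y| are monotone in the
  exponent.\<close>

definition Im_range :: real where
  "Im_range = 1 + (\<Sum>\<alpha>=1..q. \<bar>Im (a \<alpha> + a' \<alpha>)\<bar>)"

lemma pole_set_cases:
  assumes "\<sigma> \<in> pole_set k"
  obtains j l m where "j \<in> {1..q}" "a j + (of_int k + \<sigma>) / 2 = - of_nat l"
    "a' j + (- of_int k + \<sigma>) / 2 = - of_nat m"
proof -
  from assms obtain j where j: "j \<in> {1..q}" "a j + (of_int k + \<sigma>) / 2 \<in> \<int>\<^sub>\<le>\<^sub>0"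
    "a' j + (- of_int k + \<sigma>) / 2 \<in> \<int>\<^sub>\<le>\<^sub>0"
    unfolding pole_set_def GammaC_pole_def by blast
  from j(2,3) obtain l m where "a j + (of_int k + \<sigma>) / 2 = - of_nat l"
    "a' j + (- of_int k + \<sigma>) / 2 = - of_nat m"
    by (metis nonpos_Ints_cases')
  with j(1) show ?thesis
    by (rule that)
qed

lemma pole_Im_less:
  assumes "\<sigma> \<in> pole_set k"
  shows "\<bar>Im \<sigma>\<bar> < Im_range"
proof -
  from assms obtain j l m where j: "j \<in> {1..q}" "a j + (of_int k + \<sigma>) / 2 = - of_nat l"
    "a' j + (- of_int k + \<sigma>) / 2 = - of_nat m"
    by (rule pole_set_cases)
  have "Im (a j + (of_int k + \<sigma>) / 2) = 0" "Im (a' j + (- of_int k + \<sigma>) / 2) = 0"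
    unfolding j by auto
  then have "Im \<sigma> = - Im (a j + a' j)"
    by simp
  then have "\<bar>Im \<sigma>\<bar> = \<bar>Im (a j + a' j)\<bar>"
    by linarith
  also have "\<dots> \<le> (\<Sum>\<alpha>=1..q. \<bar>Im (a \<alpha> + a' \<alpha>)\<bar>)"
    using j(1) by (intro member_le_sum) auto
  finally show ?thesis
    by (simp add: Im_range_def)
qed

text \<open>The strip bound is transported to the left by repeated shifts, each gaining the factor
  \<rho>. Beyond \<open>Im_range\<close> there are no poles, so no shift is obstructed.\<close>

lemma F_decay:
  obtains C l T where "C \<ge> 0" "l > 0" "T \<ge> Im_range"
    "\<And>x y. x \<le> 0 \<Longrightarrow> \<bar>y\<bar> \<ge> T \<Longrightarrow> norm (F k (Complex x y)) \<le> C * \<bar>y\<bar> powr (- \<delta>) * exp (l * x)"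
proof -
  obtain \<rho> B where \<rho>: "0 < \<rho>" "\<rho> < 1" and shift:
    "\<And>\<sigma>. norm \<sigma> \<ge> B \<Longrightarrow> Re \<sigma> \<le> 0 \<Longrightarrow> \<sigma> - 2 \<notin> pole_set k \<Longrightarrow> norm (F k (\<sigma> - 2)) \<le> \<rho> * norm (F k \<sigma>)"
    using F_shift_contracts[of k] by blast
  from F_strip_bounded[of k] obtain C T where C: "C > 0" "T > 0" and strip:
    "\<And>x y. x \<in> {-2..0} \<Longrightarrow> \<bar>y\<bar> \<ge> T \<Longrightarrow> norm (F k (Complex x y)) \<le> C * \<bar>y\<bar> powr (- \<delta> + (real q - real p) * x)"
    unfolding strip_bounded_def by blast
  \<comment> \<open>Chosen so that exp(- 2 l) = \<rho>: a shift by 2 gains precisely the decay of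
    exp(l x) over the same distance.\<close>
  define l where "l = - ln \<rho> / 2"
  define T1 where "T1 = Max {T, B, Im_range}"
  have T1: "T1 \<ge> T" "T1 \<ge> B" "T1 \<ge> Im_range"
    by (simp_all add: T1_def)
  have "Im_range \<ge> 1"
    by (simp add: Im_range_def sum_nonneg)
  have "l > 0" and el: "exp (- (2 * l)) = \<rho>"
    using \<rho> by (auto simp: l_def)
  have strip': "norm (F k (Complex x y)) \<le> C * \<bar>y\<bar> powr (- \<delta>)" if "x \<in> {-2..0}" "\<bar>y\<bar> \<ge> T1" for x y
  proof -
    have "(real q - real p) * x \<le> 0"
      using that direction by (auto intro: mult_nonneg_nonpos)
    then have "\<bar>y\<bar> powr (- \<delta> + (real q - real p) * x) \<le> \<bar>y\<bar> powr (- \<delta>)"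
      using that T1 \<open>Im_range \<ge> 1\<close> by (intro powr_mono) auto
    then have "C * \<bar>y\<bar> powr (- \<delta> + (real q - real p) * x) \<le> C * \<bar>y\<bar> powr (- \<delta>)"
      using C by simp
    with strip[of x y] that T1 show ?thesis
      by linarith
  qed
  have main: "norm (F k (Complex x y)) \<le> C * exp (2 * l) * \<bar>y\<bar> powr (- \<delta>) * exp (l * x)"
    if "\<bar>y\<bar> \<ge> T1" "x \<le> 0" "x \<ge> - 2 * real (Suc n)" for x y n
    using that
  proof (induction n arbitrary: x)
    case 0
    \<comment> \<open>On the first strip there is no decay yet; the factor exp(2 l) in the constant
      pays for exp(l x), which is at least exp(- 2 l) there.\<close>
    have "1 \<le> exp (2 * l + l * x)"
      using 0 \<open>l > 0\<close> mult_left_mono[of "-2" x l] by simp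
    then have "C * \<bar>y\<bar> powr (- \<delta>) * 1 \<le> C * \<bar>y\<bar> powr (- \<delta>) * exp (2 * l + l * x)"
      using C by (intro mult_left_mono) auto
    with strip'[of x y] 0 show ?case
      by (simp add: exp_add mult_ac)
  next
    case (Suc n)
    show ?case
    proof (cases "x \<ge> - 2")
      case True
      show ?thesis
        by (rule Suc.IH) (use Suc.prems True in auto)
    next
      case False
      define \<sigma> where "\<sigma> = Complex (x + 2) y"
      have \<sigma>: "\<sigma> - 2 = Complex x y"
        by (simp add: \<sigma>_def complex_eq_iff)
      have "norm (F k (\<sigma> - 2)) \<le> \<rho> * norm (F k \<sigma>)"
      proof (rule shift)
        show "norm \<sigma> \<ge> B"
          using abs_Im_le_cmod[of \<sigma>] Suc.prems T1 by (simp add: \<sigma>_def)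
        show "Re \<sigma> \<le> 0"
          using False by (simp add: \<sigma>_def)
        show "\<sigma> - 2 \<notin> pole_set k"
          using pole_Im_less[of "\<sigma> - 2" k] Suc.prems T1 by (auto simp: \<sigma>)
      qed
      also have "\<dots> \<le> \<rho> * (C * exp (2 * l) * \<bar>y\<bar> powr (- \<delta>) * exp (l * (x + 2)))"
        unfolding \<sigma>_def using Suc.prems False \<rho> by (intro mult_left_mono Suc.IH) auto
      also have "\<dots> = C * exp (2 * l) * \<bar>y\<bar> powr (- \<delta>) * (exp (- (2 * l)) * exp (l * (x + 2)))"
        unfolding el by (simp add: mult_ac)
      also have "exp (- (2 * l)) * exp (l * (x + 2)) = exp (l * x)"
        by (simp add: algebra_simps flip: exp_add)
      finally show ?thesis
        unfolding \<sigma> .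
    qed
  qed
  have "norm (F k (Complex x y)) \<le> C * exp (2 * l) * \<bar>y\<bar> powr (- \<delta>) * exp (l * x)"
    if "x \<le> 0" "\<bar>y\<bar> \<ge> T1" for x y
  proof -
    obtain n where "- x \<le> real n"
      using real_arch_simple by blast
    then have "x \<ge> - 2 * real (Suc n)"
      using that(1) by simp
    with that show ?thesis
      by (intro main)
  qed
  moreover have "C * exp (2 * l) \<ge> 0"
    using C by simp
  ultimately show ?thesis
    using that[of "C * exp (2 * l)" l T1] T1(3) \<open>l > 0\<close> by blast
qed

section \<open>Enumeration of the poles and vertical lines avoiding them\<close>

definition pole_index :: "int \<Rightarrow> (nat \<times> nat \<times> nat) set" where
  "pole_index k = {(j, l, m). j \<in> {1..q} \<and> of_nat m - of_nat l = of_int k + a j - a' j}"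

definition pole_at :: "nat \<times> nat \<times> nat \<Rightarrow> complex" where
  "pole_at = (\<lambda>(j, l, m). - (a j + a' j) - of_nat l - of_nat m)"

lemma pole_at_half:
  assumes "(j, l, m) \<in> pole_index k"
  shows "(of_int k + pole_at (j, l, m)) / 2 = - a j - of_nat l"
    and "(- of_int k + pole_at (j, l, m)) / 2 = - a' j - of_nat m"
proof -
  have k: "of_int k = of_nat m - of_nat l - a j + a' j"
    using assms by (simp add: pole_index_def algebra_simps)
  show "(of_int k + pole_at (j, l, m)) / 2 = - a j - of_nat l"
    "(- of_int k + pole_at (j, l, m)) / 2 = - a' j - of_nat m"
    unfolding pole_at_def k by (simp_all add: field_simps)
qed

lemma pole_set_eq: "pole_set k = pole_at ` pole_index k"
proof (intro equalityI subsetI)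
  fix \<sigma> assume "\<sigma> \<in> pole_set k"
  then obtain j l m where j: "j \<in> {1..q}" "a j + (of_int k + \<sigma>) / 2 = - of_nat l"
    "a' j + (- of_int k + \<sigma>) / 2 = - of_nat m"
    by (rule pole_set_cases)
  have "(a j + (of_int k + \<sigma>) / 2) - (a' j + (- of_int k + \<sigma>) / 2) = of_int k + a j - a' j"
    "- (a j + a' j) + (a j + (of_int k + \<sigma>) / 2) + (a' j + (- of_int k + \<sigma>) / 2) = \<sigma>"
    by (simp_all add: field_simps)
  with j have "(j, l, m) \<in> pole_index k" "\<sigma> = pole_at (j, l, m)"
    by (auto simp: pole_index_def pole_at_def)
  then show "\<sigma> \<in> pole_at ` pole_index k"
    by blast
next
  fix \<sigma> assume "\<sigma> \<in> pole_at ` pole_index k"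
  then obtain j l m where x: "(j, l, m) \<in> pole_index k" and \<sigma>: "\<sigma> = pole_at (j, l, m)"
    by auto
  have "j \<in> {1..q}"
    using x by (simp add: pole_index_def)
  moreover have "GammaC_pole (a j + (of_int k + \<sigma>) / 2) (a' j + (- of_int k + \<sigma>) / 2)"
    unfolding \<sigma> pole_at_half[OF x] by (simp add: GammaC_pole_def)
  ultimately show "\<sigma> \<in> pole_set k"
    unfolding pole_set_def by blast
qed

text \<open>For fixed k the position of a pole determines both a_j + l and a'_j + m. A coincidence
  for two different j would make the difference of their a-parameters an integer, against
  nonresonance.\<close>

lemma pole_at_inj: "inj_on pole_at (pole_index k)"
proof
  fix x y assume x: "x \<in> pole_index k" and y: "y \<in> pole_index k" and eq: "pole_at x = pole_at y"
  obtain j l m where x_eq: "x = (j, l, m)" by (cases x) auto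
  obtain j' l' m' where y_eq: "y = (j', l', m')" by (cases y) auto
  have h: "- a j - of_nat l = - a j' - of_nat l'" "- a' j - of_nat m = - a' j' - of_nat m'"
    using pole_at_half[OF x[unfolded x_eq]] pole_at_half[OF y[unfolded y_eq]] eq
    unfolding x_eq y_eq by metis+
  have "a j' - a j = of_nat l - of_nat l'"
    using h(1) by (simp add: algebra_simps)
  also have "\<dots> \<in> \<int>"
    by (intro Ints_diff Ints_of_nat)
  finally have "j' = j"
    using nonresonant[of j j'] x y unfolding x_eq y_eq pole_index_def by auto
  with h show "x = y"
    by (simp add: x_eq y_eq)
qed

lemma Re_pole_neg:
  assumes "x \<in> pole_index k"
  shows "Re (pole_at x) < 0"
  using assms a_pos[of "fst x"] by (auto simp: pole_index_def pole_at_def)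

lemma finite_poles_right: "finite {x \<in> pole_index k. Re (pole_at x) > - Y}"
proof (rule finite_subset)
  show "{x \<in> pole_index k. Re (pole_at x) > - Y} \<subseteq> {1..q} \<times> {..nat \<lceil>Y\<rceil>} \<times> {..nat \<lceil>Y\<rceil>}"
  proof
    fix x assume x: "x \<in> {x \<in> pole_index k. Re (pole_at x) > - Y}"
    obtain j l m where x_eq: "x = (j, l, m)" by (cases x) auto
    have "j \<in> {1..q}" "Re (a j + a' j) + real l + real m < Y"
      using x unfolding x_eq pole_index_def pole_at_def by auto
    with a_pos[of j] have "real l \<le> Y" "real m \<le> Y"
      by linarith+
    then show "x \<in> {1..q} \<times> {..nat \<lceil>Y\<rceil>} \<times> {..nat \<lceil>Y\<rceil>}"
      using \<open>j \<in> {1..q}\<close> unfolding x_eq by (auto simp: le_nat_iff) linarith+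
  qed
qed auto

text \<open>Only countably many values of c are bad, so the interval (0, 1) contains a good one. The
  lines are translates of each other by 2, which lets the contraction be iterated from line to
  line.\<close>

lemma regular_lines:
  obtains c where "0 < c" "c < 1" "\<And>x n. x \<in> pole_index k \<Longrightarrow> Re (pole_at x) \<noteq> - (c + 2 * real n)"
proof -
  define N where "N = (\<lambda>(x, n). - Re (pole_at x) - 2 * real n) ` (UNIV :: ((nat \<times> nat \<times> nat) \<times> nat) set)"
  have "countable N"
    unfolding N_def by simp
  then have "\<not> {0<..<1::real} \<subseteq> N"
    using uncountable_open_interval[of 0 "1::real"] countable_subset by auto
  then obtain c where "c \<in> {0<..<1}" "c \<notin> N"
    by blast
  then have c: "0 < c" "c < 1" "c \<notin> N"
    by auto
  have "Re (pole_at x) \<noteq> - (c + 2 * real n)" for x n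
  proof
    assume "Re (pole_at x) = - (c + 2 * real n)"
    then have "c = (\<lambda>(x, n). - Re (pole_at x) - 2 * real n) (x, n)"
      by simp
    with c(3) show False
      unfolding N_def by blast
  qed
  with c that show ?thesis
    by blast
qed

text \<open>On one regular line the integrand is bounded over the compact range of heights; every
  further line to the left gains a factor \<rho>. Unlike in \<open>F_decay\<close>, low heights are
  included, so regularity of the lines replaces the distance from the poles.\<close>

lemma F_left_small:
  assumes c: "0 < c" "\<And>x n. x \<in> pole_index k \<Longrightarrow> Re (pole_at x) \<noteq> - (c + 2 * real n)" and "e > 0"
  shows "eventually (\<lambda>n. \<forall>y\<in>{- T..T}. norm (F k (Complex (- (c + 2 * real n)) y)) \<le> e) sequentially"
proof -
  obtain \<rho> B where \<rho>: "0 < \<rho>" "\<rho> < 1" and shift: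
    "\<And>\<sigma>. norm \<sigma> \<ge> B \<Longrightarrow> Re \<sigma> \<le> 0 \<Longrightarrow> \<sigma> - 2 \<notin> pole_set k \<Longrightarrow> norm (F k (\<sigma> - 2)) \<le> \<rho> * norm (F k \<sigma>)"
    using F_shift_contracts[of k] by blast
  \<comment> \<open>From this line on the real part alone makes |\<sigma>| at least
    \<open>B\<close>, whatever the height.\<close>
  obtain n0 :: nat where n0: "B \<le> real n0"
    using real_arch_simple by blast
  have reg: "Complex (- (c + 2 * real n)) y \<in> b_halfplane - pole_set k" for n y
  proof
    show "Complex (- (c + 2 * real n)) y \<in> b_halfplane"
      using c(1) by (intro Re_nonpos_in_b_halfplane) simp
    show "Complex (- (c + 2 * real n)) y \<notin> pole_set k"
    proof
      assume "Complex (- (c + 2 * real n)) y \<in> pole_set k"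
      then obtain x where x: "x \<in> pole_index k" "Complex (- (c + 2 * real n)) y = pole_at x"
        unfolding pole_set_eq by blast
      from c(2)[OF x(1), of n] show False
        unfolding x(2)[symmetric] by simp
    qed
  qed
  have "continuous_on {- T..T} (\<lambda>y. F k (Complex (- (c + 2 * real n0)) y))"
  proof (rule continuous_on_compose2[OF holomorphic_on_imp_continuous_on[OF F_holomorphic]])
    show "continuous_on {- T..T} (Complex (- (c + 2 * real n0)))"
      unfolding Complex_eq by (intro continuous_intros)
  qed (use reg in auto)
  then have "bounded ((\<lambda>y. F k (Complex (- (c + 2 * real n0)) y)) ` {- T..T})"
    by (intro compact_imp_bounded compact_continuous_image) auto
  then obtain M where "\<forall>w\<in>(\<lambda>y. F k (Complex (- (c + 2 * real n0)) y)) ` {- T..T}. norm w \<le> M"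
    unfolding bounded_iff by blast
  then have M: "norm (F k (Complex (- (c + 2 * real n0)) y)) \<le> M" if "y \<in> {- T..T}" for y
    using that by blast
  have geo: "norm (F k (Complex (- (c + 2 * real (n + n0))) y)) \<le> \<rho> ^ n * M" if y: "y \<in> {- T..T}" for y n
  proof (induction n)
    case 0
    then show ?case using M[OF y] by simp
  next
    case (Suc n)
    define \<sigma> where "\<sigma> = Complex (- (c + 2 * real (n + n0))) y"
    have \<sigma>: "\<sigma> - 2 = Complex (- (c + 2 * real (Suc n + n0))) y"
      by (simp add: \<sigma>_def complex_eq_iff)
    have "norm (F k (\<sigma> - 2)) \<le> \<rho> * norm (F k \<sigma>)"
    proof (rule shift)
      show "norm \<sigma> \<ge> B"
        using abs_Re_le_cmod[of \<sigma>] n0 c(1) by (simp add: \<sigma>_def)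
      show "Re \<sigma> \<le> 0"
        using c(1) by (simp add: \<sigma>_def)
      show "\<sigma> - 2 \<notin> pole_set k"
        unfolding \<sigma> using reg by blast
    qed
    also have "\<dots> \<le> \<rho> * (\<rho> ^ n * M)"
      unfolding \<sigma>_def using Suc.IH \<rho> by (intro mult_left_mono) auto
    finally show ?case
      unfolding \<sigma> by (simp only: power_Suc mult.assoc)
  qed
  have "(\<lambda>n. \<rho> ^ n * M) \<longlonglongrightarrow> 0 * M"
    using \<rho> by (intro tendsto_intros LIMSEQ_realpow_zero) auto
  then have "eventually (\<lambda>n. \<rho> ^ n * M < e) sequentially"
    using \<open>e > 0\<close> by (intro order_tendstoD) auto
  then have "eventually (\<lambda>n. \<forall>y\<in>{- T..T}. norm (F k (Complex (- (c + 2 * real (n + n0))) y)) \<le> e) sequentially"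
  proof eventually_elim
    case (elim n)
    show ?case
    proof
      fix y assume "y \<in> {- T..T}"
      from geo[OF this, of n] elim show "norm (F k (Complex (- (c + 2 * real (n + n0))) y)) \<le> e"
        by linarith
    qed
  qed
  then show ?thesis
    by (subst (asm) eventually_sequentially_seg)
qed

section \<open>Residues as products of hypergeometric terms\<close>

definition coefficient :: "nat \<Rightarrow> complex" where
  "coefficient j = 2 * cpower z (a j) (a' j) *
     (\<Prod>\<beta>=1..p. GammaC (b \<beta> + a j) (b' \<beta> + a' j)) *
     (\<Prod>\<alpha>\<in>{1..q} - {j}. GammaC (a \<alpha> - a j) (a' \<alpha> - a' j))"

definition holo_term :: "nat \<Rightarrow> nat \<Rightarrow> complex" where
  "holo_term j l = (\<Prod>\<beta>=1..p. pochhammer (b \<beta> + a j) l) /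
     (fact l * (\<Prod>\<alpha>\<in>{1..q} - {j}. pochhammer (1 - a \<alpha> + a j) l)) * ((-1) ^ q * z) ^ l"

definition antiholo_term :: "nat \<Rightarrow> nat \<Rightarrow> complex" where
  "antiholo_term j m = (\<Prod>\<beta>=1..p. pochhammer (b' \<beta> + a' j) m) /
     (fact m * (\<Prod>\<alpha>\<in>{1..q} - {j}. pochhammer (1 - a' \<alpha> + a' j) m)) * ((-1) ^ p * cnj z) ^ m"

definition residue_term :: "nat \<times> nat \<times> nat \<Rightarrow> complex" where
  "residue_term = (\<lambda>(j, l, m). coefficient j * (holo_term j l * antiholo_term j m))"

text \<open>The signs explain the arguments of the two series: the simple pole gives (-1)^l and each
  of the q - 1 remaining a-factors another (-1)^l, making ((-1)^q)^l, while the p b-factors give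
  ((-1)^p)^m. The factorials come from the pole, the Pochhammer symbols from shifting the other
  factors.\<close>

lemma residue_value:
  assumes "j \<in> {1..q}"
  shows "2 * ((-1) ^ l / (fact l * fact m)) *
           (\<Prod>\<alpha>\<in>{1..q} - {j}. GammaC (a \<alpha> - a j - of_nat l) (a' \<alpha> - a' j - of_nat m)) *
           (\<Prod>\<beta>=1..p. GammaC (b \<beta> + a j + of_nat l) (b' \<beta> + a' j + of_nat m)) *
           cpower z (a j + of_nat l) (a' j + of_nat m) = residue_term (j, l, m)"
proof -
  have A: "GammaC (a \<alpha> - a j - of_nat l) (a' \<alpha> - a' j - of_nat m) =
      (-1) ^ l * GammaC (a \<alpha> - a j) (a' \<alpha> - a' j) /
      (pochhammer (1 - a \<alpha> + a j) l * pochhammer (1 - a' \<alpha> + a' j) m)" if "\<alpha> \<in> {1..q} - {j}" for \<alpha>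
  proof -
    have "a \<alpha> - a j - (a' \<alpha> - a' j) \<in> \<int>"
      using Ints_diff[OF a_Lambda[of \<alpha>] a_Lambda[of j]] that assms by (simp add: algebra_simps)
    from GammaC_shift_minus[OF nonresonant[OF assms that] this, of l m] show ?thesis
      by (simp add: algebra_simps)
  qed
  have B: "GammaC (b \<beta> + a j + of_nat l) (b' \<beta> + a' j + of_nat m) =
      (-1) ^ m * pochhammer (b \<beta> + a j) l * pochhammer (b' \<beta> + a' j) m * GammaC (b \<beta> + a j) (b' \<beta> + a' j)"
    if "\<beta> \<in> {1..p}" for \<beta>
  proof (rule GammaC_shift)
    show "b \<beta> + a j - (b' \<beta> + a' j) \<in> \<int>"
      using Ints_add[OF a_Lambda[OF assms] b_Lambda[OF that]] by (simp add: algebra_simps)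
    show "\<not> GammaC_pole (b \<beta> + a j) (b' \<beta> + a' j)"
      using GammaC_pole_imp_Re_le[of "b \<beta> + a j" "b' \<beta> + a' j"] a_pos[OF assms] b_pos[OF that] by auto
  qed
  have q: "q = Suc (card ({1..q} - {j}))"
    using assms by (simp add: card_Diff_singleton)
  have "((-1) ^ n) ^ l = ((-1 :: complex) ^ l) ^ n" for n
    by (simp only: mult.commute flip: power_mult)
  then have sign: "((-1) ^ q * z) ^ l = (-1) ^ l * ((-1) ^ l) ^ card ({1..q} - {j}) * z ^ l"
    by (subst q) (simp only: power_Suc power_mult_distrib)
  have sign': "((-1) ^ p * cnj z) ^ m = ((-1) ^ m) ^ p * cnj z ^ m"
    by (simp add: power_mult_distrib mult_ac flip: power_mult)
  have A': "(\<Prod>\<alpha>\<in>{1..q} - {j}. GammaC (a \<alpha> - a j - of_nat l) (a' \<alpha> - a' j - of_nat m)) =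
      ((-1) ^ l) ^ card ({1..q} - {j}) * (\<Prod>\<alpha>\<in>{1..q} - {j}. GammaC (a \<alpha> - a j) (a' \<alpha> - a' j)) /
      ((\<Prod>\<alpha>\<in>{1..q} - {j}. pochhammer (1 - a \<alpha> + a j) l) * (\<Prod>\<alpha>\<in>{1..q} - {j}. pochhammer (1 - a' \<alpha> + a' j) m))"
    by (subst prod.cong[OF refl A]) (simp_all add: prod_dividef prod.distrib)
  have B': "(\<Prod>\<beta>=1..p. GammaC (b \<beta> + a j + of_nat l) (b' \<beta> + a' j + of_nat m)) =
      ((-1) ^ m) ^ p * (\<Prod>\<beta>=1..p. pochhammer (b \<beta> + a j) l) * (\<Prod>\<beta>=1..p. pochhammer (b' \<beta> + a' j) m) *
      (\<Prod>\<beta>=1..p. GammaC (b \<beta> + a j) (b' \<beta> + a' j))"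
    by (subst prod.cong[OF refl B]) (simp_all add: prod.distrib)
  show ?thesis
    unfolding A' B' cpower_shift[OF z_nz a_Lambda[OF assms]] residue_term_def coefficient_def
      holo_term_def antiholo_term_def prod.case sign sign' by (simp add: ac_simps)
qed

lemma residue_F:
  assumes x: "(j, l, m) \<in> pole_index k"
  shows "residue (F k) (pole_at (j, l, m)) = residue_term (j, l, m)"
proof -
  define \<sigma>0 where "\<sigma>0 = pole_at (j, l, m)"
  have j: "j \<in> {1..q}"
    using x by (simp add: pole_index_def)
  note half = pole_at_half[OF x, folded \<sigma>0_def]
  define G where "G \<sigma> =
     (\<Prod>\<alpha>\<in>{1..q} - {j}. GammaC (a \<alpha> + (of_int k + \<sigma>) / 2) (a' \<alpha> + (- of_int k + \<sigma>) / 2)) *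
     (\<Prod>\<beta>=1..p. GammaC (b \<beta> + (- of_int k - \<sigma>) / 2) (b' \<beta> + (of_int k - \<sigma>) / 2)) *
     cpower z ((- of_int k - \<sigma>) / 2) ((of_int k - \<sigma>) / 2)" for \<sigma>
  have F: "F k \<sigma> = GammaC (a j + (of_int k + \<sigma>) / 2) (a' j + (- of_int k + \<sigma>) / 2) * G \<sigma>" for \<sigma>
    unfolding integrandC_def kernelC_def G_def using j by (subst prod.remove[of _ j]) (auto simp: mult_ac)
  \<comment> \<open>Only finitely many poles lie to the right of this line, so removing all of them
    except \<open>\<sigma>0\<close> leaves an open set.\<close>
  define P where "P = pole_at ` {x \<in> pole_index k. Re (pole_at x) > Re \<sigma>0 - 1}"
  have "finite P"
    unfolding P_def using finite_poles_right[of k "1 - Re \<sigma>0"] by (intro finite_imageI) simp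
  define V where "V = (b_halfplane \<inter> {\<sigma>. Re \<sigma> > Re \<sigma>0 - 1}) - (P - {\<sigma>0})"
  have "open V"
    unfolding V_def using \<open>finite P\<close>
    by (intro open_Diff open_Int b_halfplane_convex open_halfspace_Re_gt finite_imp_closed) auto
  have "\<sigma>0 \<in> V"
    using Re_pole_neg[OF x] by (auto simp: V_def \<sigma>0_def intro!: Re_nonpos_in_b_halfplane)
  have V_pole: "\<sigma> = \<sigma>0" if "\<sigma> \<in> V" "\<sigma> \<in> pole_set k" for \<sigma>
    using that by (auto simp: V_def P_def pole_set_eq)
  \<comment> \<open>Nonresonance makes the pole simple: if another a-factor were singular at
    \<open>\<sigma>0\<close>, its parameter would differ from \<open>a j\<close> by an
    integer.\<close>
  have "GammaC_pole (a \<alpha> + (of_int k + \<sigma>) / 2) (a' \<alpha> + (- of_int k + \<sigma>) / 2) \<Longrightarrow> False"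
    if "\<sigma> \<in> V" "\<alpha> \<in> {1..q} - {j}" for \<sigma> \<alpha>
  proof -
    assume pole: "GammaC_pole (a \<alpha> + (of_int k + \<sigma>) / 2) (a' \<alpha> + (- of_int k + \<sigma>) / 2)"
    then have "\<sigma> \<in> pole_set k"
      using that(2) unfolding pole_set_def by blast
    then have "\<sigma> = \<sigma>0"
      by (rule V_pole[OF that(1)])
    with pole half(1) have "a \<alpha> + (- a j - of_nat l) \<in> \<int>"
      using nonpos_Ints_subset_Ints unfolding GammaC_pole_def by auto
    from Ints_add[OF this Ints_of_nat[of l]] nonresonant[OF j that(2)] show False
      by simp
  qed
  then have "G holomorphic_on V"
    unfolding G_def[abs_def]
    by (intro holomorphic_on_mult holomorphic_on_prod cpower_integrand_holomorphic
          a_factor_holomorphic b_factor_holomorphic) (auto simp: V_def)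
  then have "isCont G \<sigma>0"
    using \<open>open V\<close> \<open>\<sigma>0 \<in> V\<close> holomorphic_on_imp_continuous_on continuous_on_eq_continuous_at by blast
  have "residue (F k) \<sigma>0 = 2 * ((-1) ^ l / (fact l * fact m)) * G \<sigma>0"
  proof (rule residue_simple'[OF \<open>open V\<close> \<open>\<sigma>0 \<in> V\<close>])
    show "F k holomorphic_on V - {\<sigma>0}"
      by (rule holomorphic_on_subset[OF F_holomorphic]) (use V_pole in \<open>auto simp: V_def\<close>)
    define c where "c = a j + of_int k / 2"
    define c' where "c' = a' j - of_int k / 2"
    have eq: "a j + (of_int k + \<sigma>) / 2 = c + \<sigma> / 2" "a' j + (- of_int k + \<sigma>) / 2 = c' + \<sigma> / 2" for \<sigma>
      by (simp_all add: c_def c'_def field_simps)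
    have c: "c + \<sigma>0 / 2 = - of_nat l" "c' + \<sigma>0 / 2 = - of_nat m"
      unfolding eq[symmetric] half by simp_all
    have "filterlim (\<lambda>\<sigma>. \<sigma> / 2) (at (\<sigma>0 / 2)) (at \<sigma>0)"
      unfolding filterlim_at by (auto simp: eventually_at_filter intro!: tendsto_intros)
    \<comment> \<open>The Gamma factor depends on \<sigma> / 2, so its residue in \<sigma> is
      doubled; this is the origin of the leading 2 in \<open>SigmaC_plus\<close>.\<close>
    from filterlim_compose[OF GammaC_simple_pole[OF c] this]
    have "(\<lambda>\<sigma>. 2 * (GammaC (c + \<sigma> / 2) (c' + \<sigma> / 2) * (\<sigma> / 2 - \<sigma>0 / 2)) * G \<sigma>) \<midarrow>\<sigma>0\<rightarrow>
            2 * ((-1) ^ l / (fact l * fact m)) * G \<sigma>0"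
      using \<open>isCont G \<sigma>0\<close> by (intro tendsto_mult tendsto_const) (auto simp: isCont_def)
    then show "(\<lambda>\<sigma>. F k \<sigma> * (\<sigma> - \<sigma>0)) \<midarrow>\<sigma>0\<rightarrow> 2 * ((-1) ^ l / (fact l * fact m)) * G \<sigma>0"
      unfolding F eq by (rule back_subst[of "\<lambda>f. f \<midarrow>\<sigma>0\<rightarrow> _"]) (auto simp: field_simps)
  qed
  also have "G \<sigma>0 = (\<Prod>\<alpha>\<in>{1..q} - {j}. GammaC (a \<alpha> - a j - of_nat l) (a' \<alpha> - a' j - of_nat m)) *
           (\<Prod>\<beta>=1..p. GammaC (b \<beta> + a j + of_nat l) (b' \<beta> + a' j + of_nat m)) *
           cpower z (a j + of_nat l) (a' j + of_nat m)"
  proof -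
    have "(- of_int k - \<sigma>0) / 2 = - ((of_int k + \<sigma>0) / 2)" "(of_int k - \<sigma>0) / 2 = - ((- of_int k + \<sigma>0) / 2)"
      by (simp_all add: field_simps)
    then show ?thesis
      unfolding G_def by (simp only: half) (simp add: algebra_simps)
  qed
  finally show ?thesis
    unfolding \<sigma>0_def using residue_value[OF j, of l m] by (simp add: mult.assoc)
qed

lemma imag_axis_F_has_integral:
  assumes "(residue_term has_sum S) (pole_index k)"
  shows "((\<lambda>t::real. F k (\<i> * of_real t) * \<i>) has_integral 2 * pi * \<i> * S) UNIV"
proof -
  obtain C l T where *: "C \<ge> 0" "l > 0" "T \<ge> Im_range"
    "\<And>x y. x \<le> 0 \<Longrightarrow> \<bar>y\<bar> \<ge> T \<Longrightarrow> norm (F k (Complex x y)) \<le> C * \<bar>y\<bar> powr (- \<delta>) * exp (l * x)"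
    using F_decay[of k] by blast
  obtain c where c: "0 < c" "c < 1" "\<And>x n. x \<in> pole_index k \<Longrightarrow> Re (pole_at x) \<noteq> - (c + 2 * real n)"
    using regular_lines[of k] by blast
  have "Im_range > 0"
    unfolding Im_range_def by (intro add_pos_nonneg sum_nonneg) auto
  interpret left_residue_sum "F k" b_halfplane pole_at residue_term "pole_index k" S T \<delta> l C
    "\<lambda>n. c + 2 * real n"
  proof
    show "F k holomorphic_on b_halfplane - pole_at ` pole_index k"
      using F_holomorphic by (simp add: pole_set_eq)
    show "\<bar>Im (pole_at x)\<bar> < T" if "x \<in> pole_index k" for x
      using pole_Im_less[of "pole_at x" k] that *(3) by (auto simp: pole_set_eq)
    show "residue (F k) (pole_at x) = residue_term x" if "x \<in> pole_index k" for x
      using that residue_F by (cases x) auto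
    show "filterlim (\<lambda>n. c + 2 * real n) at_top sequentially"
      by (intro filterlim_tendsto_add_at_top[OF tendsto_const]
            filterlim_tendsto_pos_mult_at_top[OF tendsto_const] filterlim_real_sequentially) simp
  qed (use * c \<delta>_pos assms \<open>Im_range > 0\<close> b_halfplane_convex Re_nonpos_in_b_halfplane pole_at_inj
         Re_pole_neg finite_poles_right F_left_small in auto)
  show ?thesis
    by (rule imag_axis_has_integral)
qed

end

section \<open>Summation of the residues\<close>

lemma hypergeomF_eq_suminf:
  "hypergeomF [c \<beta>. \<beta> \<leftarrow> [1..<Suc p]] [d \<alpha>. \<alpha> \<leftarrow> [1..<Suc q], \<alpha> \<noteq> j] x =
     (\<Sum>m. (\<Prod>\<beta>=1..p. pochhammer (c \<beta>) m) /
             (fact m * (\<Prod>\<alpha>\<in>{1..q} - {j}. pochhammer (d \<alpha>) m)) * x ^ m)"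
proof -
  have "[d \<alpha>. \<alpha> \<leftarrow> xs, \<alpha> \<noteq> j] = map d (filter (\<lambda>\<alpha>. \<alpha> \<noteq> j) xs)" for xs
    by (induction xs) auto
  moreover have "(\<Prod>u\<leftarrow>map c [1..<Suc p]. pochhammer u m) = (\<Prod>\<beta>=1..p. pochhammer (c \<beta>) m)" for m
    by (subst map_map, subst prod.distinct_set_conv_list[symmetric])
       (auto simp: atLeastLessThanSuc_atLeastAtMost o_def simp del: upt_Suc)
  moreover have "(\<Prod>u\<leftarrow>map d (filter (\<lambda>\<alpha>. \<alpha> \<noteq> j) [1..<Suc q]). pochhammer u m) =
          (\<Prod>\<alpha>\<in>{1..q} - {j}. pochhammer (d \<alpha>) m)" for m
    by (subst map_map, subst prod.distinct_set_conv_list[symmetric])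
       (auto intro!: prod.cong simp del: upt_Suc)
  ultimately show ?thesis
    unfolding hypergeomF_eq by simp
qed

text \<open>Ratio test: consecutive terms differ by x times a rational function of m, which tends to
  0 or, for equally many factors above and below, to 1.\<close>

lemma hypergeometric_term_summable:
  fixes c :: "'i \<Rightarrow> complex" and d :: "'j \<Rightarrow> complex"
  assumes fin: "finite I" "finite J" and j: "j \<in> J"
    and size: "card I < card J \<or> card I = card J \<and> norm x < 1"
  shows "summable (\<lambda>m. norm ((\<Prod>i\<in>I. pochhammer (c i) m) /
             (fact m * (\<Prod>i\<in>J - {j}. pochhammer (d i) m)) * x ^ m))"
proof -
  define t where "t m = (\<Prod>i\<in>I. pochhammer (c i) m) /
             (fact m * (\<Prod>i\<in>J - {j}. pochhammer (d i) m)) * x ^ m" for m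
  \<comment> \<open>The factor m + 1 from the factorial is treated as a lower parameter 1 in the
    vacant place j, so that numerator and denominator have \<open>card I\<close> and
    \<open>card J\<close> factors.\<close>
  define e where "e i = (if i = j then 1 else d i)" for i
  define r where "r w = (\<Prod>i\<in>I. w + c i) / (\<Prod>i\<in>J. w + e i)" for w
  have rec: "t (Suc m) = r (of_nat m) * x * t m" for m
  proof -
    have "(\<Prod>i\<in>J. of_nat m + e i) = of_nat (Suc m) * (\<Prod>i\<in>J - {j}. of_nat m + d i)"
      using prod.remove[OF fin(2) j, of "\<lambda>i. of_nat m + e i"] by (simp add: e_def add_ac)
    then show ?thesis
      by (simp add: t_def r_def pochhammer_Suc prod.distrib ac_simps)
  qed
  have "((\<lambda>m. norm (r (of_nat m) * x)) \<longlonglongrightarrow> norm ((if card I = card J then 1 else 0) * x))"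
    unfolding r_def using size fin
    by (intro tendsto_norm tendsto_mult tendsto_const filterlim_compose[OF prod_ratio_asymptotics tendsto_of_nat]) auto
  moreover have "norm ((if card I = card J then 1 else 0) * x) < 1"
    using size by auto
  ultimately obtain K where K: "norm ((if card I = card J then 1 else 0) * x) < K" "K < 1"
    "eventually (\<lambda>m. norm (r (of_nat m) * x) < K) sequentially"
    using dense order_tendstoD(2) by metis
  then obtain N where N: "\<And>m. m \<ge> N \<Longrightarrow> norm (r (of_nat m) * x) < K"
    unfolding eventually_sequentially by blast
  have "summable (\<lambda>m. norm (t m))"
  proof (rule summable_ratio_test[OF K(2)])
    fix m assume "m \<ge> N"
    from less_imp_le[OF N[OF this]] show "norm (norm (t (Suc m))) \<le> K * norm (norm (t m))"
      unfolding rec norm_mult by (simp add: mult_right_mono)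
  qed
  then show ?thesis
    by (simp add: t_def)
qed

lemma has_sum_product_of_series:
  fixes u v :: "nat \<Rightarrow> 'a :: {real_normed_field, banach}"
  assumes u: "summable (\<lambda>l. norm (u l))" and v: "summable (\<lambda>m. norm (v m))"
  shows "((\<lambda>(l, m). u l * v m) has_sum (suminf u * suminf v)) UNIV"
proof -
  have hs: "(w has_sum suminf w) UNIV" if "summable (\<lambda>l. norm (w l))" for w :: "nat \<Rightarrow> 'b :: {real_normed_field, banach}"
    using that by (intro norm_summable_imp_has_sum summable_sums) (auto dest: summable_norm_cancel)
  have "(\<lambda>x. norm (case x of (l, m) \<Rightarrow> u l * v m)) summable_on Sigma UNIV (\<lambda>_. UNIV)"
  proof (rule summable_on_SigmaI)
    show "((\<lambda>m. norm (case (l, m) of (l, m) \<Rightarrow> u l * v m)) has_sum norm (u l) * (\<Sum>m. norm (v m))) UNIV" for l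
      unfolding prod.case norm_mult using v by (intro has_sum_cmult_right hs) simp
    have "((\<lambda>l. norm (u l)) has_sum (\<Sum>l. norm (u l))) UNIV"
      using u by (intro hs) simp
    from has_sum_cmult_left[OF this]
    show "(\<lambda>l. norm (u l) * (\<Sum>m. norm (v m))) summable_on UNIV"
      unfolding summable_on_def by blast
  qed auto
  then have "(\<lambda>(l, m). u l * v m) summable_on Sigma UNIV (\<lambda>_. UNIV)"
    by (rule abs_summable_summable)
  then have "((\<lambda>(l, m). u l * v m) has_sum (suminf u * suminf v)) (Sigma UNIV (\<lambda>_. UNIV))"
    by (intro has_sum_SigmaI[where g = "\<lambda>l. u l * suminf v"])
       (auto intro!: has_sum_cmult_right has_sum_cmult_left hs u v)
  then show ?thesis
    by simp
qed

context meijer_left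
begin

text \<open>Summability is established over all triples at once, without reference to k; this is
  what justifies regrouping by k afterwards.\<close>

lemma residue_term_has_sum:
  "(residue_term has_sum (\<Sum>j=1..q. coefficient j * (suminf (holo_term j) * suminf (antiholo_term j))))
     ({1..q} \<times> UNIV)"
proof (rule has_sum_SigmaI)
  let ?t = "\<lambda>j (l, m). holo_term j l * antiholo_term j m"
  have size: "card {1..p} < card {1..q} \<or> card {1..p} = card {1..q} \<and> norm ((-1) ^ n * w) < 1"
    if "norm w = norm z" for n and w :: complex
    using direction that by (auto simp: norm_mult norm_power)
  have h: "summable (\<lambda>l. norm (holo_term j l))" if "j \<in> {1..q}" for j
    unfolding holo_term_def by (intro hypergeometric_term_summable size that) auto
  have ah: "summable (\<lambda>m. norm (antiholo_term j m))" if "j \<in> {1..q}" for j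
    unfolding antiholo_term_def by (intro hypergeometric_term_summable size that) auto
  show "((\<lambda>y. residue_term (j, y)) has_sum
          coefficient j * (suminf (holo_term j) * suminf (antiholo_term j))) UNIV"
    if "j \<in> {1..q}" for j
    using has_sum_cmult_right[OF has_sum_product_of_series[OF h[OF that] ah[OF that]], of "coefficient j"]
    by (simp add: residue_term_def case_prod_beta)
  show "((\<lambda>j. coefficient j * (suminf (holo_term j) * suminf (antiholo_term j))) has_sum
         (\<Sum>j=1..q. coefficient j * (suminf (holo_term j) * suminf (antiholo_term j)))) {1..q}"
    by (rule has_sum_finite) simp
  have "(\<lambda>x. norm (residue_term x)) summable_on ({1..q} \<times> UNIV)"
  proof (rule summable_on_SigmaI)
    show "((\<lambda>y. norm (residue_term (j, y))) has_sum
            norm (coefficient j) * ((\<Sum>l. norm (holo_term j l)) * (\<Sum>m. norm (antiholo_term j m)))) UNIV"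
      if "j \<in> {1..q}" for j
      using has_sum_cmult_right[OF has_sum_product_of_series[of "\<lambda>l. norm (holo_term j l)"
            "\<lambda>m. norm (antiholo_term j m)"], of "norm (coefficient j)"] h[OF that] ah[OF that]
      by (simp add: residue_term_def case_prod_beta norm_mult)
  qed auto
  then show "residue_term summable_on ({1..q} \<times> UNIV)"
    by (rule abs_summable_summable)
qed

text \<open>Every triple (j, l, m) belongs to exactly one k, namely m - l - (a_j - a'_j), which is
  an integer. The index sets thus partition all triples, and the unordered sum may be taken block by
  block.\<close>

lemma residue_sums_has_sum:
  shows "((\<lambda>k. infsum residue_term (pole_index k)) has_sum
           (\<Sum>j=1..q. coefficient j * (suminf (holo_term j) * suminf (antiholo_term j)))) UNIV"
    and "(residue_term has_sum infsum residue_term (pole_index k)) (pole_index k)"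
proof -
  have sub: "pole_index k \<subseteq> {1..q} \<times> UNIV" for k
    by (auto simp: pole_index_def)
  have "residue_term summable_on ({1..q} \<times> UNIV)"
    using residue_term_has_sum by (auto simp: summable_on_def)
  then show inner: "(residue_term has_sum infsum residue_term (pole_index k)) (pole_index k)" for k
    by (rule has_sum_infsum[OF summable_on_subset_banach]) (rule sub)
  have bij: "bij_betw snd (Sigma UNIV pole_index) ({1..q} \<times> UNIV)"
    unfolding bij_betw_def
  proof
    show "inj_on snd (Sigma UNIV pole_index)"
    proof (rule inj_onI)
      fix x y assume xy: "x \<in> Sigma UNIV pole_index" "y \<in> Sigma UNIV pole_index" "snd x = snd y"
      obtain k j l m where x: "x = (k, j, l, m)" by (cases x) auto
      obtain k' where y: "y = (k', j, l, m)"
        using xy(3) x by (cases y) auto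
      have "of_int k + a j - a' j = of_int k' + a j - a' j"
        using xy(1,2) unfolding x y pole_index_def by auto
      then show "x = y"
        unfolding x y by simp
    qed
    show "snd ` Sigma UNIV pole_index = {1..q} \<times> UNIV"
    proof (intro equalityI subsetI)
      fix x assume "x \<in> {1..q} \<times> (UNIV :: (nat \<times> nat) set)"
      then obtain j l m where x: "x = (j, l, m)" "j \<in> {1..q}" by auto
      from a_Lambda[OF x(2)] obtain n where n: "a j - a' j = of_int n"
        by (auto elim!: Ints_cases)
      have "of_nat m - of_nat l = of_int (int m - int l - n) + (a j - a' j)"
        unfolding n by simp
      then have "(int m - int l - n, x) \<in> Sigma UNIV pole_index"
        using x by (simp add: pole_index_def algebra_simps)
      then show "x \<in> snd ` Sigma UNIV pole_index"
        by force
    next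
      fix x assume "x \<in> snd ` Sigma UNIV pole_index"
      then obtain k where "x \<in> pole_index k"
        by auto
      with sub show "x \<in> {1..q} \<times> UNIV"
        by blast
    qed
  qed
  have "((\<lambda>x. residue_term (snd x)) has_sum
          (\<Sum>j=1..q. coefficient j * (suminf (holo_term j) * suminf (antiholo_term j)))) (Sigma UNIV pole_index)"
    using residue_term_has_sum by (simp add: has_sum_reindex_bij_betw[OF bij])
  then show "((\<lambda>k. infsum residue_term (pole_index k)) has_sum
           (\<Sum>j=1..q. coefficient j * (suminf (holo_term j) * suminf (antiholo_term j)))) UNIV"
    by (rule has_sum_SigmaD) (use inner in simp)
qed

theorem meijerGC_eq_SigmaC_plus:
  "meijerGC_converges p q a a' b b' z"
  "meijerGC p q a a' b b' z = SigmaC_plus p q a a' b b' z"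
proof -
  have int: "((\<lambda>t::real. F k (\<i> * of_real t) * \<i>) has_integral
               2 * pi * \<i> * infsum residue_term (pole_index k)) UNIV" for k
    by (rule imag_axis_F_has_integral[OF residue_sums_has_sum(2)])
  have val: "imag_axis_integral (F k) = 2 * pi * \<i> * infsum residue_term (pole_index k)" for k
    unfolding imag_axis_integral_def using int by (rule integral_unique)
  have sum: "((\<lambda>k. imag_axis_integral (F k)) has_sum 2 * pi * \<i> *
        (\<Sum>j=1..q. coefficient j * (suminf (holo_term j) * suminf (antiholo_term j)))) UNIV"
    unfolding val by (intro has_sum_cmult_right residue_sums_has_sum(1))
  show "meijerGC_converges p q a a' b b' z"
    unfolding meijerGC_converges_def imag_axis_integrable_def
    using has_integral_integrable[OF int] has_sum_imp_summable[OF sum] by blast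
  have "meijerGC p q a a' b b' z = (\<Sum>j=1..q. coefficient j * (suminf (holo_term j) * suminf (antiholo_term j)))"
    unfolding meijerGC_def infsumI[OF sum] by simp
  also have "\<dots> = SigmaC_plus p q a a' b b' z"
    unfolding SigmaC_plus_def hypergeomF_eq_suminf coefficient_def holo_term_def[abs_def]
      antiholo_term_def[abs_def] sum_distrib_left by (simp add: mult_ac)
  finally show "meijerGC p q a a' b b' z = SigmaC_plus p q a a' b b' z" .
qed

end

section \<open>Exchanging the two families of parameters\<close>

lemma cpower_inverse:
  assumes "z \<noteq> 0" and "a - a' \<in> \<int>"
  shows "cpower (inverse z) a a' = cpower z (- a) (- a')"
proof -
  from assms(2) obtain n where n: "a - a' = of_int n"
    by (auto elim!: Ints_cases)
  have n': "- a - (- a') = of_int (- n)"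
    using n by (simp add: algebra_simps)
  have w: "inverse z / of_real (norm (inverse z)) = inverse (z / of_real (norm z))"
    by (simp add: norm_inverse divide_inverse)
  have r: "of_real (norm (inverse z)) powr (a + a') = of_real (norm z) powr (- a + - a')"
    using assms(1)
    by (simp add: powr_def Ln_of_real norm_inverse ln_inverse algebra_simps del: of_real_inverse)
  have "cpower (inverse z) a a' =
          (inverse z / of_real (norm (inverse z))) powi n * of_real (norm (inverse z)) powr (a + a')"
    by (rule cpower_int_diff) (use assms(1) n in auto)
  also have "\<dots> = (z / of_real (norm z)) powi (- n) * of_real (norm z) powr (- a + - a')"
    unfolding w r by (simp only: power_int_inverse power_int_minus)
  also have "\<dots> = cpower z (- a) (- a')"
    using assms(1) n' by (rule cpower_int_diff[symmetric])
  finally show ?thesis .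
qed

lemma integrandC_swap:
  assumes "z \<noteq> 0"
  shows "integrandC p q a a' b b' z k \<sigma> = integrandC q p b b' a a' (inverse z) (- k) (- \<sigma>)"
proof -
  have "(of_int k + \<sigma>) / 2 - (- of_int k + \<sigma>) / 2 = of_int k"
    by (simp add: field_simps)
  then have "cpower (inverse z) ((of_int k + \<sigma>) / 2) ((- of_int k + \<sigma>) / 2) =
             cpower z (- ((of_int k + \<sigma>) / 2)) (- ((- of_int k + \<sigma>) / 2))"
    by (intro cpower_inverse assms) simp
  also have "- ((of_int k + \<sigma>) / 2) = (- of_int k - \<sigma>) / 2"
    by (simp add: field_simps)
  also have "- ((- of_int k + \<sigma>) / 2) = (of_int k - \<sigma>) / 2"
    by (simp add: field_simps)
  finally show ?thesis
    by (simp add: integrandC_def kernelC_def mult.commute)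
qed

text \<open>The reflection is carried out on compact intervals and transferred by the limit
  criterion, which covers conditionally convergent integrals.\<close>

lemma has_integral_reflect_UNIV:
  fixes f :: "real \<Rightarrow> 'a :: banach"
  assumes "(f has_integral I) UNIV"
  shows "((\<lambda>x. f (- x)) has_integral I) UNIV"
proof -
  have int: "(\<lambda>x. f (- x)) integrable_on cbox a b"
    "integral (cbox a b) (\<lambda>x. f (- x)) = integral (cbox (- b) (- a)) f" for a b
    using has_integral_alt'[of f I UNIV] assms
      integral_reflect[where a = "- b" and b = "- a" and f = f]
      integrable_reflect[where a = "- b" and b = "- a" and f = f]
    by auto
  have "\<exists>B>0. \<forall>a b. ball 0 B \<subseteq> cbox a b \<longrightarrow> norm (integral (cbox a b) (\<lambda>x. f (- x)) - I) < e"
    if "e > 0" for e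
  proof -
    from assms that obtain B where B: "B > 0"
      "\<And>a b. ball 0 B \<subseteq> cbox a b \<Longrightarrow> norm (integral (cbox a b) f - I) < e"
      unfolding has_integral_alt'[of f I UNIV] by auto
    have "ball 0 B \<subseteq> cbox (- b) (- a)" if "ball 0 B \<subseteq> cbox a b" for a b :: real
    proof
      fix x :: real assume "x \<in> ball 0 B"
      then have "- x \<in> ball 0 B"
        by simp
      with that have "- x \<in> cbox a b"
        by blast
      then show "x \<in> cbox (- b) (- a)"
        by auto
    qed
    with B show ?thesis
      unfolding int(2) by blast
  qed
  then show ?thesis
    unfolding has_integral_alt'[of _ I UNIV] using int(1) by simp
qed

text \<open>No sign appears: under \<sigma> -> -\<sigma> the sign of the differential cancels
  against the reversed orientation of the axis.\<close>

lemma imag_axis_has_integral_swap: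
  assumes "((\<lambda>t::real. f (\<i> * of_real t) * \<i>) has_integral I) UNIV"
  shows "((\<lambda>t::real. f (- (\<i> * of_real t)) * \<i>) has_integral I) UNIV"
  using has_integral_reflect_UNIV[OF assms] by simp

lemma meijerGC_swap:
  assumes "z \<noteq> 0" and conv: "meijerGC_converges q p b b' a a' (inverse z)"
  shows "meijerGC_converges p q a a' b b' z"
    and "meijerGC p q a a' b b' z = meijerGC q p b b' a a' (inverse z)"
proof -
  let ?G = "integrandC q p b b' a a' (inverse z)"
  let ?F = "integrandC p q a a' b b' z"
  have "((\<lambda>t::real. ?G k (\<i> * of_real t) * \<i>) has_integral imag_axis_integral (?G k)) UNIV" for k
    using conv unfolding meijerGC_converges_def imag_axis_integrable_def imag_axis_integral_def
    by (blast intro: integrable_integral)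
  then have int: "((\<lambda>t::real. ?F k (\<i> * of_real t) * \<i>) has_integral imag_axis_integral (?G (- k))) UNIV" for k
    unfolding integrandC_swap[OF assms(1), of p q] by (rule imag_axis_has_integral_swap)
  then have val: "imag_axis_integral (?F k) = imag_axis_integral (?G (- k))" for k
    unfolding imag_axis_integral_def[of "?F k"] by (rule integral_unique)
  have bij: "bij_betw uminus UNIV (UNIV :: int set)"
    by (rule bij_uminus)
  show "meijerGC_converges p q a a' b b' z"
    using has_integral_integrable[OF int] conv
    unfolding meijerGC_converges_def imag_axis_integrable_def val
      summable_on_reindex_bij_betw[OF bij, of "\<lambda>k. imag_axis_integral (?G k)"] by blast
  show "meijerGC p q a a' b b' z = meijerGC q p b b' a a' (inverse z)"
    unfolding meijerGC_def val infsum_reindex_bij_betw[OF bij, of "\<lambda>k. imag_axis_integral (?G k)"] ..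
qed

lemma SigmaC_minus_eq_SigmaC_plus:
  assumes "z \<noteq> 0" and "\<And>\<beta>. \<beta> \<in> {1..p} \<Longrightarrow> b \<beta> - b' \<beta> \<in> \<int>"
  shows "SigmaC_minus p q a a' b b' z = SigmaC_plus q p b b' a a' (inverse z)"
  unfolding SigmaC_minus_def SigmaC_plus_def using assms
  by (intro arg_cong2[where f = "(*)"] sum.cong refl) (auto simp: cpower_inverse)

theorem theorem1p2:
  fixes p q :: nat and a a' b b' :: "nat \<Rightarrow> complex" and z :: complex
  assumes "\<And>\<alpha>. \<alpha> \<in> {1..q} \<Longrightarrow> (a \<alpha>, a' \<alpha>) \<in> Lambda_C"
    and "\<And>\<beta>. \<beta> \<in> {1..p} \<Longrightarrow> (b \<beta>, b' \<beta>) \<in> Lambda_C"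
    and "\<And>\<alpha>. \<alpha> \<in> {1..q} \<Longrightarrow> Re (a \<alpha> + a' \<alpha>) > 0"
    and "\<And>\<beta>. \<beta> \<in> {1..p} \<Longrightarrow> Re (b \<beta> + b' \<beta>) > 0"
    and "(\<Sum>\<alpha>=1..q. Re (a \<alpha> + a' \<alpha>)) + (\<Sum>\<beta>=1..p. Re (b \<beta> + b' \<beta>)) < real (p + q)"
    and "z \<noteq> 0"
  shows
    "(q > p \<and> SigmaC_well_defined p q a a' b b' \<longrightarrow>
        meijerGC_converges p q a a' b b' z \<and>
        meijerGC p q a a' b b' z = SigmaC_plus p q a a' b b' z) \<and>
     (q < p \<and> SigmaC_well_defined q p b b' a a' \<longrightarrow>
        meijerGC_converges p q a a' b b' z \<and>
        meijerGC p q a a' b b' z = SigmaC_minus p q a a' b b' z) \<and>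
     (p = q \<and> norm z < 1 \<and> SigmaC_well_defined p q a a' b b' \<longrightarrow>
        meijerGC_converges p q a a' b b' z \<and>
        meijerGC p q a a' b b' z = SigmaC_plus p q a a' b b' z) \<and>
     (p = q \<and> norm z > 1 \<and> SigmaC_well_defined q p b b' a a' \<longrightarrow>
        meijerGC_converges p q a a' b b' z \<and>
        meijerGC p q a a' b b' z = SigmaC_minus p q a a' b b' z)"
proof -
  have a: "a \<alpha> - a' \<alpha> \<in> \<int>" if "\<alpha> \<in> {1..q}" for \<alpha>
    using assms(1)[OF that] by (simp add: Lambda_C_def)
  have b: "b \<beta> - b' \<beta> \<in> \<int>" if "\<beta> \<in> {1..p}" for \<beta>
    using assms(2)[OF that] by (simp add: Lambda_C_def)
  have plus: "meijerGC_converges p q a a' b b' z \<and> meijerGC p q a a' b b' z = SigmaC_plus p q a a' b b' z"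
    if dir: "p < q \<or> p = q \<and> norm z < 1" and wd: "SigmaC_well_defined p q a a' b b'"
  proof -
    \<comment> \<open>Under the positivity assumptions, meaningfulness of the right-hand side is
      equivalent to the simplicity condition on the poles.\<close>
    have nonres: "\<forall>j\<in>{1..q}. \<forall>\<alpha>\<in>{1..q} - {j}. a \<alpha> - a j \<notin> \<int>"
      using wd SigmaC_well_defined_iff[of q a a' p b b'] assms(1,3,4) by blast
    interpret meijer_left p q a a' b b' z
      by (intro meijer_left.intro a b assms(3-6) dir) (use nonres in auto)
    show ?thesis
      using meijerGC_eq_SigmaC_plus by blast
  qed
  have minus: "meijerGC_converges p q a a' b b' z \<and> meijerGC p q a a' b b' z = SigmaC_minus p q a a' b b' z"
    if dir: "q < p \<or> p = q \<and> norm z > 1" and wd: "SigmaC_well_defined q p b b' a a'"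
  proof -
    have nonres: "\<forall>j\<in>{1..p}. \<forall>\<beta>\<in>{1..p} - {j}. b \<beta> - b j \<notin> \<int>"
      using wd SigmaC_well_defined_iff[of p b b' q a a'] assms(2,3,4) by blast
    have sum: "(\<Sum>\<beta>=1..p. Re (b \<beta> + b' \<beta>)) + (\<Sum>\<alpha>=1..q. Re (a \<alpha> + a' \<alpha>)) < real (q + p)"
      using assms(5) by (simp only: add.commute)
    have "q < p \<or> q = p \<and> norm (inverse z) < 1"
      using dir by (auto simp: norm_inverse inverse_less_1_iff)
    moreover have "inverse z \<noteq> 0"
      using assms(6) by simp
    ultimately interpret swapped: meijer_left q p b b' a a' "inverse z"
      by (intro meijer_left.intro a b assms(3,4) sum) (use nonres in auto)
    note swap = meijerGC_swap[OF assms(6) swapped.meijerGC_eq_SigmaC_plus(1)]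
    have "SigmaC_minus p q a a' b b' z = SigmaC_plus q p b b' a a' (inverse z)"
      by (intro SigmaC_minus_eq_SigmaC_plus assms(6) b)
    with swap swapped.meijerGC_eq_SigmaC_plus(2) show ?thesis
      by simp
  qed
  show ?thesis
    using plus minus by blast
qed

end
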